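(* Let $m\ge2$. For a proper scoring rule $L$ and a constant $\kappa_L>0$ depending on $L$, consider the inequalities, for any $\eta,q\in\Delta_m$, $$\text{(A)}\quad B_L(\eta,q)=H_L(q)-H_L(\eta)-(q-\eta)^{T}\partial H_L(q)\ge\frac{\kappa_L}{2}\|\eta-q\|_1^2,$$ $$\text{(B)}\quad\frac{\kappa_L}{2}\big(B^{\mathrm{zo}}(\eta,q)\big)^2\le B_L(\eta,q).$$ Inequalities (A) and (B) hold for the following proper scoring rules. (i) Consider the pairwise loss $$L(j,q)=\sum_{k\in\{1,\ldots,m\},k\ne j}\Big\{-\partial f_0\big(\tfrac{q_j}{q_k}\big)+\tfrac{q_k}{q_j}\partial f_0\big(\tfrac{q_k}{q_j}\big)-f_0\big(\tfrac{q_k}{q_j}\big)\Big\},$$ with a univariate (twice-differentiable, convex) function $f_0$ defined such that the associated two-class loss $L_{f_0}$ satisfies $$\frac{d}{dq_1}L_{f_0}(j,q)=-\{1\{j=1\}-q_1\}\,w(q_1),\qquad j=1,2,$$ with the weight function $w(q_1)=2^{2\nu}q_1^{\nu-1}q_2^{\nu-1}$ for $(q_1,q_2)^{T}\in\Delta_2$. If $\nu\le0$, then (A) and (B) are valid with $\kappa_L=2$. (ii) Consider the simultaneous loss $L(j,q)=(q_j/\|q\|_\beta)^{\beta-1}$ with $\beta\in(0,1)$, where $\|q\|_\beta=(\sum_{k=1}^mq_k^\beta)^{1/\beta}$. Then (A) and (B) are valid with $$\kappa_L=\begin{cases}(1-\beta)\,m^{(1-1/\beta)(2\beta-1)}\,2^{2-2\beta},&\text{if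 }\beta\in[1/2,1),\\(1-\beta)\,2^{1/\beta-1},&\text{if }\beta\in(0,1/2].\end{cases}$$ The bounds from the two segments both give $\kappa_L=1$ at $\beta=1/2$.
   Context: $\Delta_m=\{q\in\mathbb R^m: q_j\ge 0,\ \sum_{j=1}^m q_j=1\}$ is the probability simplex; $\|b\|_1=\sum_j|b_j|$. A scoring rule is a loss $L(j,q)$, with label $j\in\{1,\ldots,m\}$, whose action $q$ is in $\Delta_m$. Its generalized entropy is $H_L(\eta)=\inf_{q\in\Delta_m}\sum_{j=1}^m\eta_jL(j,q)$, its regret is $B_L(\eta,q)=\sum_{j=1}^m\eta_jL(j,q)-H_L(\eta)$, and it is proper if $H_L(\eta)=\sum_{j=1}^m\eta_jL(j,\eta)$ for all $\eta\in\Delta_m$. For a proper scoring rule, the regret is the Bregman divergence displayed in (A), where $-\partial H_L$ is a sub-gradient of the convex function $-H_L$. The zero-one loss is $L^{\mathrm{zo}}(j,q)=1\{j\ne\mathrm{argmax}_kq_k\}$ (if not unique, the argmax is fixed as the index of any maximum component), and $B^{\mathrm{zo}}(\eta,q)=\sum_j\eta_jL^{\mathrm{zo}}(j,q)-(1-\max_k\eta_k)$ is its regret. For a univariate convex function $f_0$ with (sub-)gradient $\partial f_0$, the two-class loss is $L_{f_0}(j,q)=-1\{j=1\}\,\partial f_0(u^q)+1\{j=2\}\{u^q\,\partial f_0(u^q)-f_0(u^q)\}$, $j=1,2$, where $u^q=q_1/q_2$ for $q=(q_1,q_2)^{T}\in\Delta_2$; $d/dq_1$ is the derivative with respect to $q_1$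 with $q_2=1-q_1$. For twice-differentiable $f_0$ the weight function is $w(q_1)=f_0''(u^q)/q_2^3$. *)

theory Defs
  imports "HOL-Analysis.Analysis"
begin

text \<open>
  Labels are the elements of a finite type \<open>'m\<close>, with \<open>m = CARD('m)\<close>, and actions are vectors of
  \<open>real ^ 'm\<close>. The losses considered are infinite on parts of the boundary of the simplex, so losses,
  entropies and regrets are \<open>ereal\<close>-valued; a label of probability zero does not contribute to a
  risk, since \<open>0 * \<infinity> = 0\<close> in \<open>ereal\<close>.
\<close>

definition prob_simplex :: "(real ^ 'm) set"
  where "prob_simplex = {q. (\<forall>j. 0 \<le> q $ j) \<and> (\<Sum>j\<in>UNIV. q $ j) = 1}"

definition norm1 :: "real ^ 'm \<Rightarrow> real"
  where "norm1 b = (\<Sum>j\<in>UNIV. \<bar>b $ j\<bar>)"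

definition risk :: "('m::finite \<Rightarrow> real ^ 'm \<Rightarrow> ereal) \<Rightarrow> real ^ 'm \<Rightarrow> real ^ 'm \<Rightarrow> ereal"
  where "risk L \<eta> q = (\<Sum>j\<in>UNIV. ereal (\<eta> $ j) * L j q)"

definition entropy :: "('m::finite \<Rightarrow> real ^ 'm \<Rightarrow> ereal) \<Rightarrow> real ^ 'm \<Rightarrow> ereal"
  where "entropy L \<eta> = (INF q\<in>prob_simplex. risk L \<eta> q)"

text \<open>
  If \<open>entropy L \<eta> = -\<infinity>\<close>, the subtraction below gives \<open>\<infinity>\<close>, also when \<open>risk L \<eta> q = -\<infinity>\<close>
  (where the regret is not determined mathematically). For the losses below, this can only
  happen for \<open>\<eta>\<close> on the boundary of the simplex, and for the pairwise loss with \<open>\<nu> \<le> -1\<close>.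
\<close>

definition regret :: "('m::finite \<Rightarrow> real ^ 'm \<Rightarrow> ereal) \<Rightarrow> real ^ 'm \<Rightarrow> real ^ 'm \<Rightarrow> ereal"
  where "regret L \<eta> q = risk L \<eta> q - entropy L \<eta>"

definition proper_scoring_rule :: "('m::finite \<Rightarrow> real ^ 'm \<Rightarrow> ereal) \<Rightarrow> bool"
  where "proper_scoring_rule L \<longleftrightarrow> (\<forall>\<eta>\<in>prob_simplex. entropy L \<eta> = risk L \<eta> \<eta>)"

text \<open>
  \<open>v\<close> is a sub-gradient at \<open>q\<close> of the function \<open>F\<close> on the simplex. It is finite if \<open>q\<close> is an
  interior point; on the boundary, a coordinate with \<open>q $ j = 0\<close>, which can only be increased,
  may have slope \<open>-\<infinity>\<close>. With real coordinates only, the entropies of the losses below would have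
  no sub-gradients at boundary points.
\<close>

definition is_subgradient_at :: "(real ^ 'm \<Rightarrow> ereal) \<Rightarrow> real ^ 'm \<Rightarrow> ('m::finite \<Rightarrow> ereal) \<Rightarrow> bool"
  where "is_subgradient_at F q v \<longleftrightarrow>
    \<bar>F q\<bar> \<noteq> \<infinity> \<and> (\<forall>j. v j \<noteq> \<infinity>) \<and> (\<forall>j. 0 < q $ j \<longrightarrow> v j \<noteq> -\<infinity>) \<and>
    (\<forall>\<eta>\<in>prob_simplex. F q + (\<Sum>j\<in>UNIV. ereal (\<eta> $ j - q $ j) * v j) \<le> F \<eta>)"

text \<open>
  As for any proper scoring rule, the identity of the regret and the Bregman
  divergence refers to a choice \<open>dH\<close> such that \<open>- dH q\<close> is a sub-gradient of \<open>- H\<close> at every \<open>q\<close>.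
  Such a sub-gradient can only exist where \<open>H q\<close> is finite.
\<close>

definition bregman_regret_bound :: "real \<Rightarrow> ('m::finite \<Rightarrow> real ^ 'm \<Rightarrow> ereal) \<Rightarrow> bool"
  where "bregman_regret_bound \<kappa> L \<longleftrightarrow>
    (\<exists>dH :: real ^ 'm \<Rightarrow> 'm \<Rightarrow> ereal.
      \<forall>q\<in>prob_simplex. \<bar>entropy L q\<bar> \<noteq> \<infinity> \<longrightarrow>
        is_subgradient_at (\<lambda>\<eta>. - entropy L \<eta>) q (\<lambda>j. - dH q j) \<and>
        (\<forall>\<eta>\<in>prob_simplex. regret L \<eta> q =
           entropy L q - entropy L \<eta> - (\<Sum>j\<in>UNIV. ereal (q $ j - \<eta> $ j) * dH q j))) \<and>
    (\<forall>\<eta>\<in>prob_simplex. \<forall>q\<in>prob_simplex.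
        regret L \<eta> q \<ge> ereal (\<kappa> / 2 * (norm1 (\<eta> - q))\<^sup>2))"

definition argmax_selector :: "(real ^ 'm \<Rightarrow> 'm) \<Rightarrow> bool"
  where "argmax_selector am \<longleftrightarrow> (\<forall>q\<in>prob_simplex. \<forall>k. q $ k \<le> q $ (am q))"

definition zo_loss :: "(real ^ 'm \<Rightarrow> 'm) \<Rightarrow> 'm \<Rightarrow> real ^ 'm \<Rightarrow> real"
  where "zo_loss am j q = of_bool (j \<noteq> am q)"

definition zo_regret :: "(real ^ 'm \<Rightarrow> 'm) \<Rightarrow> real ^ 'm \<Rightarrow> real ^ 'm \<Rightarrow> real"
  where "zo_regret am \<eta> q =
    (\<Sum>j\<in>UNIV. \<eta> $ j * zo_loss am j q) - (1 - Max (range (\<lambda>k. \<eta> $ k)))"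

definition zero_one_regret_bound ::
  "(real ^ 'm \<Rightarrow> 'm) \<Rightarrow> real \<Rightarrow> ('m::finite \<Rightarrow> real ^ 'm \<Rightarrow> ereal) \<Rightarrow> bool"
  where "zero_one_regret_bound am \<kappa> L \<longleftrightarrow>
    (\<forall>\<eta>\<in>prob_simplex. \<forall>q\<in>prob_simplex.
        ereal (\<kappa> / 2 * (zo_regret am \<eta> q)\<^sup>2) \<le> regret L \<eta> q)"

text \<open>The two-class loss, used only for \<open>q\<close> with positive components; \<open>deriv f0\<close> is \<open>\<partial>f\<^sub>0\<close>.\<close>

definition two_class_loss :: "(real \<Rightarrow> real) \<Rightarrow> 2 \<Rightarrow> real ^ 2 \<Rightarrow> real"
  where "two_class_loss f0 j q =
    (let u = q $ 1 / q $ 2 in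
      - of_bool (j = 1) * deriv f0 u + of_bool (j = 2) * (u * deriv f0 u - f0 u))"

definition two_class_weight :: "(real \<Rightarrow> real) \<Rightarrow> (real \<Rightarrow> real) \<Rightarrow> bool"
  where "two_class_weight f0 w \<longleftrightarrow>
    (\<forall>j. \<forall>x\<in>{0<..<1}.
       ((\<lambda>t. two_class_loss f0 j (vector [t, 1 - t])) has_real_derivative
          - (of_bool (j = 1) - x) * w x) (at x))"

text \<open>
  \<open>at_ratio g a b\<close> is \<open>g (a / b)\<close> for a function \<open>g\<close> on \<open>{0<..}\<close>, extended by limits to the ratios
  \<open>0 / b = 0\<close> and \<open>a / 0 = \<infinity>\<close>; the limits exist in \<open>ereal\<close> for the monotone functions \<open>-f\<^sub>0'(u)\<close> and
  \<open>u f\<^sub>0'(u) - f\<^sub>0(u)\<close> to which it is applied. The value at \<open>0 / 0\<close> is irrelevant for \<open>\<nu> \<le> 0\<close>: it only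
  occurs in \<open>pairwise_loss f0 j q\<close> if \<open>q $ j = 0\<close>, and then some other summand is \<open>\<infinity>\<close>.
\<close>

definition at_ratio :: "(real \<Rightarrow> real) \<Rightarrow> real \<Rightarrow> real \<Rightarrow> ereal"
  where "at_ratio g a b =
    (if 0 < a \<and> 0 < b then ereal (g (a / b))
     else if 0 < b then Lim (at_right 0) (\<lambda>u. ereal (g u))
     else if 0 < a then Lim at_top (\<lambda>u. ereal (g u))
     else 0)"

definition pairwise_loss :: "(real \<Rightarrow> real) \<Rightarrow> 'm::finite \<Rightarrow> real ^ 'm \<Rightarrow> ereal"
  where "pairwise_loss f0 j q =
    (\<Sum>k\<in>UNIV - {j}. at_ratio (\<lambda>u. - deriv f0 u) (q $ j) (q $ k)
                     + at_ratio (\<lambda>u. u * deriv f0 u - f0 u) (q $ k) (q $ j))"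

lemma pairwise_loss_interior:
  assumes "\<And>k. 0 < q $ k"
  shows "pairwise_loss f0 j q =
    ereal (\<Sum>k\<in>UNIV - {j}. - deriv f0 (q $ j / q $ k)
             + q $ k / q $ j * deriv f0 (q $ k / q $ j) - f0 (q $ k / q $ j))"
  by (simp add: pairwise_loss_def at_ratio_def assms algebra_simps flip: sum_ereal)

definition beta_norm :: "real \<Rightarrow> real ^ 'm \<Rightarrow> real"
  where "beta_norm \<beta> q = (\<Sum>k\<in>UNIV. (q $ k) powr \<beta>) powr (1 / \<beta>)"

text \<open>As \<open>\<beta> - 1 < 0\<close>, the loss is \<open>\<infinity>\<close> if \<open>q $ j = 0\<close> (whereas \<open>0 powr (\<beta> - 1) = 0\<close>).\<close>

definition simultaneous_loss :: "real \<Rightarrow> 'm::finite \<Rightarrow> real ^ 'm \<Rightarrow> ereal"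
  where "simultaneous_loss \<beta> j q =
    (if 0 < q $ j then ereal ((q $ j / beta_norm \<beta> q) powr (\<beta> - 1)) else \<infinity>)"

definition kappa_upper :: "nat \<Rightarrow> real \<Rightarrow> real"
  where "kappa_upper m \<beta> =
    (1 - \<beta>) * real m powr ((1 - 1 / \<beta>) * (2 * \<beta> - 1)) * 2 powr (2 - 2 * \<beta>)"

definition kappa_lower :: "real \<Rightarrow> real"
  where "kappa_lower \<beta> = (1 - \<beta>) * 2 powr (1 / \<beta> - 1)"

end

theory Submission
  imports Defs
begin

text \<open>
  Propriety, (A) and (B) all follow from the risk inequality
  \<open>risk L \<eta> \<eta> + \<kappa>/2 * (norm1 (\<eta> - q))\<^sup>2 \<le> risk L \<eta> q\<close>. It contains propriety and, with \<open>dH q j = L j q\<close>, (A);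
  it implies (B) because the zero-one regret is \<open>\<eta>\<^sub>k - \<eta>\<^sub>l\<close> with \<open>k\<close> maximising \<open>\<eta>\<close> and \<open>l\<close> maximising \<open>q\<close>, hence
  at most \<open>(\<eta>\<^sub>k - q\<^sub>k) - (\<eta>\<^sub>l - q\<^sub>l)\<close>. If \<open>\<eta>\<close> charges a zero of \<open>q\<close>, the right-hand side is infinite;
  otherwise the entropy is expanded to second order along the segment from \<open>q\<close> to \<open>\<eta>\<close> within the
  support of \<open>q\<close>.

  For the simultaneous loss the entropy is \<open>\<parallel>\<eta>\<parallel>\<^sub>\<beta>\<close>. Bounding its Hessian by the Cauchy-Schwarz inequality
  with the centred sign vector of the direction reduces the estimate to two classes. The resulting
  constant \<open>(1 - \<beta>) * 2 powr (1/\<beta> - 1)\<close> holds for all \<open>\<beta>\<close> in \<open>(0,1)\<close>, and for \<open>\<beta> \<ge> 1/2\<close> it is at least the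
  one claimed.

  For the pairwise loss, \<open>\<nu> \<le> 0\<close> makes the weight at least \<open>1 / (x * (1 - x))\<close>, its value at \<open>\<nu> = 0\<close>.
  The regret is a sum over pairs that is monotone in the weight, which leaves the logarithmic case.
  There the Hessian in direction \<open>b\<close> is a sum of
  \<open>\<eta>\<^sub>j * \<eta>\<^sub>k / (\<eta>\<^sub>j + \<eta>\<^sub>k) * (b\<^sub>j/\<eta>\<^sub>j - b\<^sub>k/\<eta>\<^sub>k)\<^sup>2\<close> over pairs; since \<open>\<eta>\<^sub>j + \<eta>\<^sub>k \<le> 1\<close>, it dominates the
  \<open>\<eta>\<close>-variance of \<open>b\<^sub>j/\<eta>\<^sub>j\<close>, which is at least \<open>(norm1 b)\<^sup>2\<close>.
\<close>

section \<open>Regret bounds from a risk inequality\<close>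

lemma risk_dominated:
  assumes "\<eta> \<in> prob_simplex" and "\<And>j. 0 < \<eta> $ j \<Longrightarrow> L j q = ereal (l j)"
  shows "risk L \<eta> q = ereal (\<Sum>j\<in>UNIV. \<eta> $ j * l j)"
proof -
  have "ereal (\<eta> $ j) * L j q = ereal (\<eta> $ j * l j)" for j
    using assms by (cases "\<eta> $ j = 0") (auto simp: prob_simplex_def less_le simp flip: zero_ereal_def)
  then show ?thesis
    by (simp add: risk_def)
qed

text \<open>Since \<open>\<infinity> + -\<infinity> = \<infinity>\<close> in \<open>ereal\<close>,
  one infinite summand decides the sum whatever the other losses are. The dual
  \<open>sum_eq_MInfty\<close> therefore has to exclude \<open>\<infinity>\<close>.\<close>

lemma risk_not_dominated:
  assumes "0 < \<eta> $ j" and "L j q = \<infinity>"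
  shows "risk L \<eta> q = \<infinity>"
  unfolding risk_def sum_Pinfty using assms by (auto intro!: bexI[of _ j])

lemma sum_eq_MInfty:
  fixes f :: "'a \<Rightarrow> ereal"
  assumes "finite A" and "\<And>i. i \<in> A \<Longrightarrow> f i \<noteq> \<infinity>" and "i \<in> A" "f i = -\<infinity>"
  shows "sum f A = -\<infinity>"
proof -
  have "\<bar>sum f A\<bar> = \<infinity>"
    unfolding sum_Inf using assms by (auto intro!: bexI[of _ i])
  moreover have "sum f A \<noteq> \<infinity>"
    unfolding sum_Pinfty using assms by auto
  ultimately show ?thesis
    by auto
qed

lemma entropy_eq_risk:
  assumes "\<eta> \<in> prob_simplex" and "\<And>q. q \<in> prob_simplex \<Longrightarrow> risk L \<eta> \<eta> \<le> risk L \<eta> q"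
  shows "entropy L \<eta> = risk L \<eta> \<eta>"
  unfolding entropy_def using assms by (intro antisym INF_lower INF_greatest)

text \<open>The risk of a fixed action \<open>q\<close> is linear in \<open>\<eta>\<close>, lies
  above the entropy and, by propriety, meets it at \<open>q\<close>. It is thus a supporting
  hyperplane, whose coefficients \<open>L j q\<close> form a super-gradient of the entropy.\<close>

lemma proper_bregman_identity:
  fixes L :: "'m::finite \<Rightarrow> real ^ 'm \<Rightarrow> ereal"
  assumes proper: "proper_scoring_rule L"
    and inf: "\<And>j. L j q = \<infinity> \<longleftrightarrow> q $ j = 0"
    and q: "q \<in> prob_simplex" and fin: "\<bar>entropy L q\<bar> \<noteq> \<infinity>"
  shows "is_subgradient_at (\<lambda>\<eta>. - entropy L \<eta>) q (\<lambda>j. - L j q)"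
    and "\<eta> \<in> prob_simplex \<Longrightarrow>
      regret L \<eta> q = entropy L q - entropy L \<eta> - (\<Sum>j\<in>UNIV. ereal (q $ j - \<eta> $ j) * L j q)"
proof -
  have Hq: "entropy L q = risk L q q"
    using proper q by (simp add: proper_scoring_rule_def)
  define l where "l j = real_of_ereal (L j q)" for j
  have nonneg: "0 \<le> q $ j" for j
    using q by (simp add: prob_simplex_def)
  \<comment> \<open>An infinite loss at a label of positive probability would make the entropy at
    \<open>q\<close> infinite.\<close>
  have l: "L j q = ereal (l j)" if "0 < q $ j" for j
  proof -
    have "\<bar>ereal (q $ j) * L j q\<bar> \<noteq> \<infinity>"
      using fin unfolding Hq risk_def sum_Inf by auto
    then have "\<bar>L j q\<bar> \<noteq> \<infinity>"
      using that by (cases "L j q") auto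
    then show ?thesis
      by (auto simp: l_def ereal_real)
  qed
  have Hq': "entropy L q = ereal (\<Sum>j\<in>UNIV. q $ j * l j)"
    unfolding Hq using q l by (rule risk_dominated)
  \<comment> \<open>At a zero of \<open>q\<close> the coefficient \<open>q $ j - \<eta> $ j\<close>
    is nonpositive and the loss is \<open>\<infinity>\<close>, so no summand is
    \<open>\<infinity>\<close>, while the one at \<open>i\<close> is
    \<open>-\<infinity>\<close>.\<close>
  have off: "(\<Sum>j\<in>UNIV. ereal (q $ j - \<eta> $ j) * L j q) = -\<infinity>" (is "sum ?f _ = _")
    and off': "(\<Sum>j\<in>UNIV. ereal (\<eta> $ j - q $ j) * - L j q) = -\<infinity>" (is "sum ?g _ = _")
    if "\<eta> \<in> prob_simplex" "0 < \<eta> $ i" "q $ i = 0" for \<eta> i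
  proof -
    have ge: "0 \<le> \<eta> $ j" for j
      using that by (simp add: prob_simplex_def)
    have "?f j \<noteq> \<infinity> \<and> ?g j \<noteq> \<infinity>" for j
    proof (cases "q $ j = 0")
      case True
      then show ?thesis
        using ge[of j] inf[of j] by (cases "\<eta> $ j = 0") (auto simp flip: zero_ereal_def)
    next
      case False
      then have "0 < q $ j"
        using nonneg[of j] by simp
      then show ?thesis
        by (simp add: l)
    qed
    moreover have "?f i = -\<infinity>" "?g i = -\<infinity>"
      using that inf[of i] by auto
    ultimately show "sum ?f UNIV = -\<infinity>" "sum ?g UNIV = -\<infinity>"
      by (auto intro!: sum_eq_MInfty[where i = i])
  qed
  have on: "risk L \<eta> q = ereal (\<Sum>j\<in>UNIV. \<eta> $ j * l j)"
    "(\<Sum>j\<in>UNIV. ereal (q $ j - \<eta> $ j) * L j q) = ereal (\<Sum>j\<in>UNIV. (q $ j - \<eta> $ j) * l j)"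
    "(\<Sum>j\<in>UNIV. ereal (\<eta> $ j - q $ j) * - L j q) = ereal (\<Sum>j\<in>UNIV. (\<eta> $ j - q $ j) * - l j)"
    if "\<eta> \<in> prob_simplex" and dom: "\<And>j. q $ j = 0 \<Longrightarrow> \<eta> $ j = 0" for \<eta>
  proof -
    have pos: "0 < q $ j" if "0 < \<eta> $ j" for j
      using that dom[of j] nonneg[of j] by (cases "q $ j = 0") auto
    show "risk L \<eta> q = ereal (\<Sum>j\<in>UNIV. \<eta> $ j * l j)"
      using \<open>\<eta> \<in> prob_simplex\<close> l[OF pos] by (rule risk_dominated)
    have "ereal (q $ j - \<eta> $ j) * L j q = ereal ((q $ j - \<eta> $ j) * l j) \<and>
        ereal (\<eta> $ j - q $ j) * - L j q = ereal ((\<eta> $ j - q $ j) * - l j)" for j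
    proof (cases "q $ j = 0")
      case True
      then show ?thesis
        by (simp add: dom flip: zero_ereal_def)
    next
      case False
      then have "0 < q $ j"
        using nonneg[of j] by simp
      then show ?thesis
        by (simp add: l)
    qed
    then show "(\<Sum>j\<in>UNIV. ereal (q $ j - \<eta> $ j) * L j q) = ereal (\<Sum>j\<in>UNIV. (q $ j - \<eta> $ j) * l j)"
      "(\<Sum>j\<in>UNIV. ereal (\<eta> $ j - q $ j) * - L j q) = ereal (\<Sum>j\<in>UNIV. (\<eta> $ j - q $ j) * - l j)"
      by simp_all
  qed
  have cases: "(\<exists>i. 0 < \<eta> $ i \<and> q $ i = 0) \<or> (\<forall>j. q $ j = 0 \<longrightarrow> \<eta> $ j = 0)"
    if "\<eta> \<in> prob_simplex" for \<eta>
    using that by (auto simp: prob_simplex_def less_le)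
  have le: "entropy L \<eta> \<le> risk L \<eta> q" for \<eta>
    unfolding entropy_def using q by (rule INF_lower)
  show "is_subgradient_at (\<lambda>\<eta>. - entropy L \<eta>) q (\<lambda>j. - L j q)"
    unfolding is_subgradient_at_def
  proof (intro conjI allI ballI impI)
    show "\<bar>- entropy L q\<bar> \<noteq> \<infinity>"
      using fin by simp
    show "- L j q \<noteq> \<infinity>" for j
      using inf[of j] l[of j] nonneg[of j] by (cases "q $ j = 0") auto
    show "- L j q \<noteq> -\<infinity>" if "0 < q $ j" for j
      using that by (simp add: l)
    fix \<eta> :: "real ^ 'm" assume \<eta>: "\<eta> \<in> prob_simplex"
    show "- entropy L q + (\<Sum>j\<in>UNIV. ereal (\<eta> $ j - q $ j) * - L j q) \<le> - entropy L \<eta>"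
      using cases[OF \<eta>]
    proof (elim disjE exE conjE)
      fix i assume i: "0 < \<eta> $ i" "q $ i = 0"
      show ?thesis
        unfolding off'[OF \<eta> i] by (simp add: Hq')
    next
      assume "\<forall>j. q $ j = 0 \<longrightarrow> \<eta> $ j = 0"
      then show ?thesis
        using le[of \<eta>] on(1)[OF \<eta>] on(3)[OF \<eta>]
        by (cases "entropy L \<eta>") (auto simp: Hq' algebra_simps sum_subtractf)
    qed
  qed
  show "regret L \<eta> q = entropy L q - entropy L \<eta> - (\<Sum>j\<in>UNIV. ereal (q $ j - \<eta> $ j) * L j q)"
    if \<eta>: "\<eta> \<in> prob_simplex"
    using cases[OF \<eta>]
  proof (elim disjE exE conjE)
    fix i assume i: "0 < \<eta> $ i" "q $ i = 0"
    then have "risk L \<eta> q = \<infinity>"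
      using inf[of i] by (intro risk_not_dominated[of \<eta> i]) auto
    then show ?thesis
      using off[OF \<eta> i] by (cases "entropy L \<eta>") (auto simp: regret_def Hq')
  next
    assume "\<forall>j. q $ j = 0 \<longrightarrow> \<eta> $ j = 0"
    then show ?thesis
      using on(1)[OF \<eta>] on(2)[OF \<eta>]
      by (cases "entropy L \<eta>") (auto simp: regret_def Hq' algebra_simps sum_subtractf)
  qed
qed

section \<open>Zero-one regret and transfer of the risk inequality\<close>

lemma zo_regret_bounds:
  fixes \<eta> q :: "real ^ 'm::finite"
  assumes am: "argmax_selector am" and \<eta>: "\<eta> \<in> prob_simplex" and q: "q \<in> prob_simplex"
  shows "0 \<le> zo_regret am \<eta> q" and "zo_regret am \<eta> q \<le> norm1 (\<eta> - q)"
proof -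
  have "(\<Sum>j\<in>UNIV. \<eta> $ j * zo_loss am j q) = (\<Sum>j\<in>UNIV. \<eta> $ j - (if j = am q then \<eta> $ j else 0))"
    by (intro sum.cong) (auto simp: zo_loss_def)
  also have "\<dots> = 1 - \<eta> $ am q"
    using \<eta> by (simp add: sum_subtractf prob_simplex_def)
  finally have eq: "zo_regret am \<eta> q = Max (range (\<lambda>k. \<eta> $ k)) - \<eta> $ am q"
    by (simp add: zo_regret_def)
  show "0 \<le> zo_regret am \<eta> q"
    unfolding eq by simp
  have "Max (range (\<lambda>k. \<eta> $ k)) \<in> range (\<lambda>k. \<eta> $ k)"
    by (rule Max_in) auto
  then obtain k where k: "Max (range (\<lambda>k. \<eta> $ k)) = \<eta> $ k"
    by blast
  have "q $ k \<le> q $ am q"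
    using am q by (simp add: argmax_selector_def)
  show "zo_regret am \<eta> q \<le> norm1 (\<eta> - q)"
  proof (cases "k = am q")
    case True
    then show ?thesis
      using eq k by (simp add: norm1_def sum_nonneg)
  next
    case False
    \<comment> \<open>These two summands already bound
      \<open>(\<eta> $ k - q $ k) - (\<eta> $ am q - q $ am q)\<close>, which is the regret plus the
      nonnegative \<open>q $ am q - q $ k\<close>.\<close>
    have "(\<Sum>j\<in>{k, am q}. \<bar>(\<eta> - q) $ j\<bar>) \<le> norm1 (\<eta> - q)"
      unfolding norm1_def by (rule sum_mono2) auto
    with False show ?thesis
      using eq k \<open>q $ k \<le> q $ am q\<close> by simp
  qed
qed

lemma regret_bounds_of_risk_bound:
  fixes L :: "'m::finite \<Rightarrow> real ^ 'm \<Rightarrow> ereal"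
  assumes am: "argmax_selector am" and \<kappa>: "0 \<le> \<kappa>"
    and inf: "\<And>q j. q \<in> prob_simplex \<Longrightarrow> L j q = \<infinity> \<longleftrightarrow> q $ j = 0"
    and bound: "\<And>\<eta> q. \<eta> \<in> prob_simplex \<Longrightarrow> q \<in> prob_simplex \<Longrightarrow>
      risk L \<eta> \<eta> + ereal (\<kappa> / 2 * (norm1 (\<eta> - q))\<^sup>2) \<le> risk L \<eta> q"
  shows "proper_scoring_rule L \<and> bregman_regret_bound \<kappa> L \<and> zero_one_regret_bound am \<kappa> L"
proof -
  have "risk L \<eta> \<eta> \<le> risk L \<eta> q" if "\<eta> \<in> prob_simplex" "q \<in> prob_simplex" for \<eta> q
  proof -
    have "risk L \<eta> \<eta> \<le> risk L \<eta> \<eta> + ereal (\<kappa> / 2 * (norm1 (\<eta> - q))\<^sup>2)"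
      using \<kappa> by (intro ereal_le_add_self) simp
    then show ?thesis
      using bound[OF that] by (rule order_trans)
  qed
  then have H: "entropy L \<eta> = risk L \<eta> \<eta>" if "\<eta> \<in> prob_simplex" for \<eta>
    using that by (intro entropy_eq_risk) auto
  then have proper: "proper_scoring_rule L"
    by (simp add: proper_scoring_rule_def)
  \<comment> \<open>If \<open>risk L \<eta> \<eta>\<close> is infinite, the subtraction gives
    \<open>\<infinity>\<close>: for \<open>-\<infinity>\<close> by convention, and for
    \<open>\<infinity>\<close> because \<open>bound\<close> then makes
    \<open>risk L \<eta> q\<close> infinite as well.\<close>
  have regret: "ereal (\<kappa> / 2 * (norm1 (\<eta> - q))\<^sup>2) \<le> regret L \<eta> q"
    if "\<eta> \<in> prob_simplex" "q \<in> prob_simplex" for \<eta> q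
    using bound[OF that] unfolding regret_def H[OF that(1)]
    by (cases "risk L \<eta> \<eta>"; cases "risk L \<eta> q") (auto simp: algebra_simps)
  have "ereal (\<kappa> / 2 * (zo_regret am \<eta> q)\<^sup>2) \<le> regret L \<eta> q"
    if "\<eta> \<in> prob_simplex" "q \<in> prob_simplex" for \<eta> q
  proof -
    have "\<kappa> / 2 * (zo_regret am \<eta> q)\<^sup>2 \<le> \<kappa> / 2 * (norm1 (\<eta> - q))\<^sup>2"
      using zo_regret_bounds[OF am that] \<kappa> by (intro mult_left_mono power_mono) auto
    then show ?thesis
      using regret[OF that] by (meson ereal_less_eq(3) order_trans)
  qed
  then show ?thesis
    unfolding bregman_regret_bound_def zero_one_regret_bound_def
    using proper regret proper_bregman_identity[OF proper inf]
    by (intro conjI exI[where x = "\<lambda>q j. L j q"] ballI impI) auto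
qed

text \<open>The derivatives are not required at \<open>t = 1\<close>: there the line segment to which this is applied
  may reach the boundary of the simplex.\<close>

lemma second_order_upper_bound:
  fixes \<phi> :: "real \<Rightarrow> real"
  assumes cont: "continuous_on {0..1} \<phi>"
    and d1: "\<And>t. 0 \<le> t \<Longrightarrow> t < 1 \<Longrightarrow> (\<phi> has_real_derivative \<phi>' t) (at t)"
    and d2: "\<And>t. 0 \<le> t \<Longrightarrow> t < 1 \<Longrightarrow> (\<phi>' has_real_derivative \<phi>'' t) (at t)"
    and le: "\<And>t. 0 \<le> t \<Longrightarrow> t < 1 \<Longrightarrow> \<phi>'' t \<le> - K"
  shows "\<phi> 1 \<le> \<phi> 0 + \<phi>' 0 - K / 2"
proof -
  have slope: "\<phi>' t \<le> \<phi>' 0 - K * t" if t: "0 \<le> t" "t < 1" for t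
  proof -
    have "\<phi>' t + K * t \<le> \<phi>' 0 + K * 0"
    proof (rule DERIV_nonpos_imp_nonincreasing[OF t(1)])
      fix x assume x: "0 \<le> x" "x \<le> t"
      have "((\<lambda>t. \<phi>' t + K * t) has_real_derivative \<phi>'' x + K) (at x)"
        using x t by (auto intro!: derivative_eq_intros d2)
      then show "\<exists>y. ((\<lambda>t. \<phi>' t + K * t) has_real_derivative y) (at x) \<and> y \<le> 0"
        using le[of x] x t by (intro exI[of _ "\<phi>'' x + K"]) auto
    qed
    then show ?thesis
      by simp
  qed
  \<comment> \<open>One order lower than \<open>slope\<close>: \<open>\<phi>\<close> minus its
    comparison parabola is nonincreasing on the open interval, and continuity carries the estimate
    to \<open>1\<close>.\<close>
  have "\<phi> 1 - \<phi>' 0 * 1 + K * 1\<^sup>2 / 2 \<le> \<phi> 0 - \<phi>' 0 * 0 + K * 0\<^sup>2 / 2"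
  proof (rule DERIV_nonpos_imp_decreasing_open[of 0 1])
    fix x :: real assume x: "0 < x" "x < 1"
    have "((\<lambda>t. \<phi> t - \<phi>' 0 * t + K * t\<^sup>2 / 2) has_real_derivative \<phi>' x - \<phi>' 0 + K * x) (at x)"
      using x by (auto intro!: derivative_eq_intros d1)
    then show "\<exists>y. ((\<lambda>t. \<phi> t - \<phi>' 0 * t + K * t\<^sup>2 / 2) has_real_derivative y) (at x) \<and> y \<le> 0"
      using slope[of x] x by (intro exI[of _ "\<phi>' x - \<phi>' 0 + K * x"]) auto
  qed (auto intro!: continuous_intros cont)
  then show ?thesis
    by simp
qed

section \<open>The logarithmic pairwise entropy\<close>

lemma segment_bounds:
  fixes p y t :: real
  assumes "0 < p" "0 \<le> y" "0 \<le> t"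
  shows "t < 1 \<Longrightarrow> 0 < p + t * (y - p)" and "t \<le> 1 \<Longrightarrow> 0 \<le> p + t * (y - p)"
proof -
  have eq: "p + t * (y - p) = (1 - t) * p + t * y"
    by (simp add: algebra_simps)
  show "t < 1 \<Longrightarrow> 0 < p + t * (y - p)"
    unfolding eq using assms by (intro add_pos_nonneg mult_pos_pos) auto
  show "t \<le> 1 \<Longrightarrow> 0 \<le> p + t * (y - p)"
    unfolding eq using assms by (intro add_nonneg_nonneg mult_nonneg_nonneg) auto
qed

text \<open>At \<open>0\<close> the product is \<open>0\<close> whatever the value of
  \<open>ln 0\<close>. Inverting the variable turns the limit there into that of
  \<open>- (ln x / x)\<close> at infinity.\<close>

lemma continuous_on_x_ln_x: "continuous_on {0..} (\<lambda>x::real. x * ln x)"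
  unfolding continuous_on_def
proof
  fix x :: real assume "x \<in> {0..}"
  show "((\<lambda>x. x * ln x) \<longlongrightarrow> x * ln x) (at x within {0..})"
  proof (cases "x = 0")
    case True
    have "- (ln x / x) = inverse x * ln (inverse x)" if "0 < x" for x :: real
      unfolding ln_inverse by (simp add: inverse_eq_divide)
    then have "\<forall>\<^sub>F x in at_top. - (ln x / x) = inverse x * ln (inverse (x::real))"
      by (rule eventually_mono[OF eventually_gt_at_top[of 0]])
    moreover have "((\<lambda>x::real. - (ln x / x)) \<longlongrightarrow> 0) at_top"
      using tendsto_minus[OF ln_x_over_x_tendsto_0] by simp
    ultimately have "((\<lambda>x::real. x * ln x) \<longlongrightarrow> 0) (at_right 0)"
      unfolding filterlim_at_right_to_top by (rule tendsto_cong[THEN iffD1])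
    then show ?thesis
      by (simp add: True at_within_Ici_at_right)
  next
    case False
    then show ?thesis
      by (intro tendsto_intros)
  qed
qed

lemma DERIV_x_ln_x: "0 < x \<Longrightarrow> ((\<lambda>x. x * ln x) has_real_derivative ln x + 1) (at x)"
  by (auto intro!: derivative_eq_intros)

text \<open>Swapping the indices of a symmetric \<open>S\<close> turns the coefficient
  \<open>u j\<close> into \<open>u k\<close>, so it may be averaged. This connects the risk form of
  the pairwise sums with the form symmetric in both classes.\<close>

lemma sum_symmetrize:
  fixes u :: "'a \<Rightarrow> real"
  assumes "\<And>j k. S j k = S k j"
  shows "(\<Sum>j\<in>I. \<Sum>k\<in>I. u j * S j k) = (\<Sum>j\<in>I. \<Sum>k\<in>I. (u j + u k) / 2 * S j k)"
proof -
  have "(\<Sum>j\<in>I. \<Sum>k\<in>I. u k * S j k) = (\<Sum>j\<in>I. \<Sum>k\<in>I. u j * S j k)"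
    by (subst sum.swap) (simp add: assms)
  then have "(\<Sum>j\<in>I. \<Sum>k\<in>I. (u j + u k) * S j k) = 2 * (\<Sum>j\<in>I. \<Sum>k\<in>I. u j * S j k)"
    by (simp add: distrib_right sum.distrib)
  moreover have "(\<Sum>j\<in>I. \<Sum>k\<in>I. (u j + u k) / 2 * S j k) = (\<Sum>j\<in>I. \<Sum>k\<in>I. (u j + u k) * S j k) / 2"
    by (simp add: sum_divide_distrib)
  ultimately show ?thesis
    by simp
qed

lemma pairwise_log_hessian:
  fixes x b :: "'a \<Rightarrow> real"
  assumes I: "finite I" and x: "\<And>j. j \<in> I \<Longrightarrow> 0 < x j" and sum_x: "sum x I = 1"
    and sum_b: "sum b I = 0"
  shows "(\<Sum>j\<in>I. \<Sum>k\<in>I. b j * ((b j + b k) / (x j + x k) - b j / x j)) \<le> - (\<Sum>j\<in>I. \<bar>b j\<bar>)\<^sup>2"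
proof -
  \<comment> \<open>Off the diagonal the left side is the right side divided by
    \<open>x j + x k \<le> 1\<close>, and both are nonpositive. The diagonal is separate because
    \<open>2 * x j \<le> 1\<close> can fail; there both sides vanish.\<close>
  have pair: "(b j + b k)\<^sup>2 / (x j + x k) - (b j)\<^sup>2 / x j - (b k)\<^sup>2 / x k
      \<le> 2 * b j * b k - x k * ((b j)\<^sup>2 / x j) - x j * ((b k)\<^sup>2 / x k)" if "j \<in> I" "k \<in> I" for j k
  proof (cases "j = k")
    case True
    then show ?thesis
      using x[OF that(1)] by (simp add: field_simps power2_eq_square)
  next
    case False
    have pos: "0 < x j" "0 < x k"
      using that x by auto
    have "sum x {j, k} \<le> sum x I"
      using I that x by (intro sum_mono2) (auto intro: less_imp_le)
    then have le1: "x j + x k \<le> 1"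
      using False sum_x by simp
    have "(b j + b k)\<^sup>2 / (x j + x k) - (b j)\<^sup>2 / x j - (b k)\<^sup>2 / x k
        = - ((x k * b j - x j * b k)\<^sup>2 / (x j * x k)) / (x j + x k)"
      using pos by (simp add: divide_simps) (simp add: algebra_simps power2_eq_square)
    also have "\<dots> \<le> - ((x k * b j - x j * b k)\<^sup>2 / (x j * x k))"
      using pos le1 by (simp add: pos_le_divide_eq mult_left_le)
    also have "\<dots> = 2 * b j * b k - x k * ((b j)\<^sup>2 / x j) - x j * ((b k)\<^sup>2 / x k)"
      using pos by (simp add: divide_simps) (simp add: algebra_simps power2_eq_square)
    finally show ?thesis .
  qed
  have half: "u / 2 * (u / s) - (v + w) / 2 = (u\<^sup>2 / s - v - w) / 2" for u s v w :: real
    by (cases "s = 0") (auto simp: field_simps power2_eq_square)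
  define V where "V = (\<Sum>j\<in>I. (b j)\<^sup>2 / x j)"
  have "(\<Sum>j\<in>I. \<Sum>k\<in>I. b j * ((b j + b k) / (x j + x k) - b j / x j))
      = (\<Sum>j\<in>I. \<Sum>k\<in>I. b j * ((b j + b k) / (x j + x k))) - (\<Sum>j\<in>I. \<Sum>k\<in>I. (b j)\<^sup>2 / x j)"
    by (simp add: right_diff_distrib sum_subtractf power2_eq_square)
  also have "(\<Sum>j\<in>I. \<Sum>k\<in>I. b j * ((b j + b k) / (x j + x k)))
      = (\<Sum>j\<in>I. \<Sum>k\<in>I. (b j + b k) / 2 * ((b j + b k) / (x j + x k)))"
    by (rule sum_symmetrize) (simp add: add.commute)
  also have "(\<Sum>j\<in>I. \<Sum>k\<in>I. (b j)\<^sup>2 / x j) = (\<Sum>j\<in>I. \<Sum>k\<in>I. ((b j)\<^sup>2 / x j + (b k)\<^sup>2 / x k) / 2)"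
    using sum_symmetrize[of "\<lambda>_ _. 1" "\<lambda>j. (b j)\<^sup>2 / x j" I] by simp
  also have "(\<Sum>j\<in>I. \<Sum>k\<in>I. (b j + b k) / 2 * ((b j + b k) / (x j + x k))) - \<dots>
      = (\<Sum>j\<in>I. \<Sum>k\<in>I. (b j + b k)\<^sup>2 / (x j + x k) - (b j)\<^sup>2 / x j - (b k)\<^sup>2 / x k) / 2"
    unfolding sum_divide_distrib sum_subtractf[symmetric]
    by (intro sum.cong refl half)
  also have "\<dots> \<le> (\<Sum>j\<in>I. \<Sum>k\<in>I. 2 * b j * b k - x k * ((b j)\<^sup>2 / x j) - x j * ((b k)\<^sup>2 / x k)) / 2"
    by (intro divide_right_mono sum_mono pair) auto
  \<comment> \<open>\<open>V\<close> is the second moment of \<open>b j / x j\<close> under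
    \<open>x\<close>, and the mean is \<open>sum b I = 0\<close>, so what remains is minus the
    variance.\<close>
  also have "\<dots> = (2 * (sum b I * sum b I) - sum x I * V - sum x I * V) / 2"
  proof -
    have "(\<Sum>j\<in>I. \<Sum>k\<in>I. x j * ((b k)\<^sup>2 / x k)) = sum x I * V"
      by (simp add: V_def sum_product)
    moreover from this have "(\<Sum>j\<in>I. \<Sum>k\<in>I. x k * ((b j)\<^sup>2 / x j)) = sum x I * V"
      by (subst sum.swap)
    moreover have "(\<Sum>j\<in>I. \<Sum>k\<in>I. 2 * b j * b k) = 2 * (sum b I * sum b I)"
      unfolding sum_product by (simp add: sum_distrib_left mult.assoc)
    ultimately show ?thesis
      by (simp only: sum_subtractf)
  qed
  also have "\<dots> = - V"
    by (simp add: sum_b sum_x)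
  finally have upper: "(\<Sum>j\<in>I. \<Sum>k\<in>I. b j * ((b j + b k) / (x j + x k) - b j / x j)) \<le> - V" .
  \<comment> \<open>Cauchy-Schwarz for this splitting bounds the squared 1-norm by
    \<open>V * sum x I = V\<close>.\<close>
  have "(\<Sum>j\<in>I. \<bar>b j\<bar>)\<^sup>2 = (\<Sum>j\<in>I. (\<bar>b j\<bar> / sqrt (x j)) * sqrt (x j))\<^sup>2"
    using x by (intro arg_cong[where f = "\<lambda>s. s\<^sup>2"] sum.cong) (auto simp: less_imp_neq[THEN not_sym])
  also have "\<dots> \<le> (\<Sum>j\<in>I. (\<bar>b j\<bar> / sqrt (x j))\<^sup>2) * (\<Sum>j\<in>I. (sqrt (x j))\<^sup>2)"
    by (rule Cauchy_Schwarz_ineq_sum)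
  also have "\<dots> = V * sum x I"
    unfolding V_def using x
    by (intro arg_cong2[where f = "(*)"] sum.cong) (auto simp: power_divide less_imp_le)
  finally show ?thesis
    using upper sum_x by simp
qed

text \<open>Along the segment from \<open>q\<close> to \<open>y\<close> the entropy
  \<open>\<phi>\<close> lies below its tangent at \<open>q\<close> by the second-order term. As the
  entropy is homogeneous of degree one, the tangent value at \<open>y\<close> is the risk of the
  action \<open>q\<close>.\<close>

lemma pairwise_log_bound:
  fixes q y :: "'a \<Rightarrow> real"
  assumes I: "finite I" and q: "\<And>j. j \<in> I \<Longrightarrow> 0 < q j" and y: "\<And>j. j \<in> I \<Longrightarrow> 0 \<le> y j"
    and sums: "sum q I = 1" "sum y I = 1"
  shows "(\<Sum>j\<in>I. \<Sum>k\<in>I. y j * (ln (y j + y k) - ln (y j))) + (\<Sum>j\<in>I. \<bar>y j - q j\<bar>)\<^sup>2 / 2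
    \<le> (\<Sum>j\<in>I. \<Sum>k\<in>I. y j * (ln (q j + q k) - ln (q j)))"
proof -
  define b where "b j = y j - q j" for j
  define x where "x j t = q j + t * b j" for j and t :: real
  \<comment> \<open>Written through \<open>x * ln x\<close>, the entropy is continuous up to
    \<open>t = 1\<close>, where coordinates may vanish; \<open>\<phi>_eq\<close> recovers the risk
    form.\<close>
  define \<phi> where "\<phi> t = (\<Sum>j\<in>I. \<Sum>k\<in>I. (x j t + x k t) * ln (x j t + x k t) / 2 - x j t * ln (x j t))" for t
  define \<phi>' where "\<phi>' t = (\<Sum>j\<in>I. \<Sum>k\<in>I. b j * (ln (x j t + x k t) - ln (x j t)))" for t
  have sum_b: "sum b I = 0"
    using sums by (simp add: b_def sum_subtractf)
  have x_pos: "0 < x j t" if "j \<in> I" "0 \<le> t" "t < 1" for j t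
    unfolding x_def b_def using that q y by (intro segment_bounds) auto
  have x_nonneg: "0 \<le> x j t" if "j \<in> I" "0 \<le> t" "t \<le> 1" for j t
    unfolding x_def b_def using that q y by (intro segment_bounds) auto
  have dx: "(x j has_real_derivative b j) (at t)" for j t
    unfolding x_def by (auto intro!: derivative_eq_intros)
  have \<phi>_eq: "\<phi> t = (\<Sum>j\<in>I. \<Sum>k\<in>I. x j t * (ln (x j t + x k t) - ln (x j t)))" for t
  proof -
    have "(\<Sum>j\<in>I. \<Sum>k\<in>I. x j t * ln (x j t + x k t))
        = (\<Sum>j\<in>I. \<Sum>k\<in>I. (x j t + x k t) / 2 * ln (x j t + x k t))"
      by (rule sum_symmetrize) (simp add: add.commute)
    then show ?thesis
      by (simp add: \<phi>_def right_diff_distrib sum_subtractf)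
  qed
  have "\<phi> 1 \<le> \<phi> 0 + \<phi>' 0 - (\<Sum>j\<in>I. \<bar>b j\<bar>)\<^sup>2 / 2"
  proof (rule second_order_upper_bound)
    have "continuous_on {0..1} (x j)" for j
      unfolding x_def by (intro continuous_intros)
    then show "continuous_on {0..1} \<phi>"
      unfolding \<phi>_def using x_nonneg
      by (intro continuous_intros continuous_on_compose2[OF continuous_on_x_ln_x]) auto
  next
    fix t :: real assume t: "0 \<le> t" "t < 1"
    have pos: "0 < x j t" if "j \<in> I" for j
      using x_pos[OF that t] .
    have "(\<phi> has_real_derivative (\<Sum>j\<in>I. \<Sum>k\<in>I.
        (b j + b k) * (ln (x j t + x k t) + 1) / 2 - b j * (ln (x j t) + 1))) (at t)"
      unfolding \<phi>_def
    proof (intro DERIV_sum)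
      fix j k assume jk: "j \<in> I" "k \<in> I"
      show "((\<lambda>t. (x j t + x k t) * ln (x j t + x k t) / 2 - x j t * ln (x j t)) has_real_derivative
          (b j + b k) * (ln (x j t + x k t) + 1) / 2 - b j * (ln (x j t) + 1)) (at t)"
      proof -
        have "((\<lambda>t. (x j t + x k t) * ln (x j t + x k t)) has_real_derivative
            (b j + b k) * (ln (x j t + x k t) + 1)) (at t)"
          unfolding mult.commute[of "b j + b k"] using pos[OF jk(1)] pos[OF jk(2)]
          by (intro DERIV_chain2[OF DERIV_x_ln_x] DERIV_add dx) simp
        moreover have "((\<lambda>t. x j t * ln (x j t)) has_real_derivative b j * (ln (x j t) + 1)) (at t)"
          unfolding mult.commute[of "b j"] using pos[OF jk(1)]
          by (intro DERIV_chain2[OF DERIV_x_ln_x] dx)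
        ultimately show ?thesis
          by (intro DERIV_diff DERIV_cdivide)
      qed
    qed
    \<comment> \<open>Undoing the symmetrisation brings the coefficient back to \<open>b j\<close>,
      after which the constants \<open>1\<close> cancel.\<close>
    moreover have "(\<Sum>j\<in>I. \<Sum>k\<in>I.
        (b j + b k) * (ln (x j t + x k t) + 1) / 2 - b j * (ln (x j t) + 1)) = \<phi>' t"
    proof -
      have "(\<Sum>j\<in>I. \<Sum>k\<in>I. (b j + b k) * (ln (x j t + x k t) + 1) / 2)
          = (\<Sum>j\<in>I. \<Sum>k\<in>I. b j * (ln (x j t + x k t) + 1))"
        unfolding times_divide_eq_left[symmetric]
        by (rule sum_symmetrize[symmetric]) (simp add: add.commute)
      then show ?thesis
        unfolding sum_subtractf
        by (simp add: \<phi>'_def sum_subtractf right_diff_distrib sum.distrib distrib_left)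
    qed
    ultimately show "(\<phi> has_real_derivative \<phi>' t) (at t)"
      by simp
    show "(\<phi>' has_real_derivative
        (\<Sum>j\<in>I. \<Sum>k\<in>I. b j * ((b j + b k) / (x j t + x k t) - b j / x j t))) (at t)"
      unfolding \<phi>'_def
    proof (intro DERIV_sum)
      fix j k assume jk: "j \<in> I" "k \<in> I"
      show "((\<lambda>t. b j * (ln (x j t + x k t) - ln (x j t))) has_real_derivative
          b j * ((b j + b k) / (x j t + x k t) - b j / x j t)) (at t)"
        using pos[OF jk(1)] pos[OF jk(2)]
        by (auto intro!: derivative_eq_intros dx simp: add_pos_pos field_simps)
    qed
    have "(\<Sum>j\<in>I. x j t) = 1"
      using sums sum_b by (simp add: x_def sum.distrib flip: sum_distrib_left)
    then show "(\<Sum>j\<in>I. \<Sum>k\<in>I. b j * ((b j + b k) / (x j t + x k t) - b j / x j t))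
        \<le> - (\<Sum>j\<in>I. \<bar>b j\<bar>)\<^sup>2"
      using pairwise_log_hessian[OF I, of "\<lambda>j. x j t" b] pos sum_b by simp
  qed
  moreover have "\<phi> 0 + \<phi>' 0 = (\<Sum>j\<in>I. \<Sum>k\<in>I. y j * (ln (q j + q k) - ln (q j)))"
    unfolding \<phi>_eq \<phi>'_def sum.distrib[symmetric] distrib_right[symmetric]
    by (simp add: x_def b_def)
  moreover have "\<phi> 1 = (\<Sum>j\<in>I. \<Sum>k\<in>I. y j * (ln (y j + y k) - ln (y j)))"
    unfolding \<phi>_eq by (simp add: x_def b_def)
  ultimately show ?thesis
    by (simp add: b_def)
qed

section \<open>Second-order bound for the \<beta>-norm\<close>

text \<open>Each \<open>x j powr (p - 1)\<close> is at most the same power of the total. In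
  \<open>powr_sum_le_sum_powr\<close> the exponent \<open>p - 1\<close> is nonpositive and the
  comparison reverses.\<close>

lemma sum_powr_le_powr_sum:
  fixes x :: "'a \<Rightarrow> real"
  assumes A: "finite A" and x: "\<And>j. j \<in> A \<Longrightarrow> 0 < x j" and p: "1 \<le> p"
  shows "(\<Sum>j\<in>A. x j powr p) \<le> (\<Sum>j\<in>A. x j) powr p"
proof -
  have le: "x j \<le> sum x A" if "j \<in> A" for j
    using that A x by (intro member_le_sum) (auto intro: less_imp_le)
  have "(\<Sum>j\<in>A. x j powr p) = (\<Sum>j\<in>A. x j * x j powr (p - 1))"
    using x by (intro sum.cong) (auto simp: powr_mult_base less_imp_le)
  also have "\<dots> \<le> (\<Sum>j\<in>A. x j * sum x A powr (p - 1))"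
    using x le p by (intro sum_mono mult_left_mono powr_mono2) (auto intro: less_imp_le)
  also have "\<dots> = (\<Sum>j\<in>A. x j) powr p"
    using x by (simp add: powr_mult_base sum_nonneg less_imp_le flip: sum_distrib_right)
  finally show ?thesis .
qed

lemma powr_sum_le_sum_powr:
  fixes x :: "'a \<Rightarrow> real"
  assumes A: "finite A" and x: "\<And>j. j \<in> A \<Longrightarrow> 0 < x j" and p: "p \<le> 1"
  shows "(\<Sum>j\<in>A. x j) powr p \<le> (\<Sum>j\<in>A. x j powr p)"
proof -
  have le: "x j \<le> sum x A" if "j \<in> A" for j
    using that A x by (intro member_le_sum) (auto intro: less_imp_le)
  have "(\<Sum>j\<in>A. x j) powr p = (\<Sum>j\<in>A. x j * sum x A powr (p - 1))"
    using x by (simp add: powr_mult_base sum_nonneg less_imp_le flip: sum_distrib_right)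
  also have "\<dots> \<le> (\<Sum>j\<in>A. x j * x j powr (p - 1))"
    using x le p by (intro sum_mono mult_left_mono powr_mono2') (auto intro: less_imp_le)
  also have "\<dots> = (\<Sum>j\<in>A. x j powr p)"
    using x by (intro sum.cong) (auto simp: powr_mult_base less_imp_le)
  finally show ?thesis .
qed

lemma powr_le_tangent:
  fixes y :: real
  assumes "0 < y" "0 \<le> \<beta>" "\<beta> \<le> 1"
  shows "y powr \<beta> \<le> 1 + \<beta> * (y - 1)"
  using Youngs_inequality_0[of \<beta> "1 - \<beta>" y 1] assms by (simp add: algebra_simps)

lemma quarter_powr: "(1 / 4 :: real) powr r = 2 powr (- 2 * r)"
  using powr_powr[of "2 :: real" "- 2" r] by (simp add: powr_minus)

text \<open>The case of two classes with masses \<open>a\<close> and \<open>1 - a\<close>. After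
  cancelling one factor \<open>S\<close>, a lower bound on \<open>S powr (1 / \<beta> - 2)\<close>
  remains, whose exponent changes sign at \<open>\<beta> = 1 / 2\<close>. So \<open>S\<close> is
  estimated from below by the arithmetic-geometric mean for small \<open>\<beta>\<close> and from
  above by concavity for large \<open>\<beta>\<close>. Equality holds at
  \<open>a = 1 / 2\<close>.\<close>

lemma two_point_norm_bound:
  fixes a \<beta> :: real
  assumes a: "0 < a" "a < 1" and \<beta>: "0 < \<beta>" "\<beta> < 1"
  defines "S \<equiv> a powr \<beta> + (1 - a) powr \<beta>"
  shows "2 powr (1 / \<beta> - 1) * (4 * (a * (1 - a)) powr (2 - \<beta>) * S) \<le> S powr (1 / \<beta> - 1)"
proof -
  define p where "p = a * (1 - a)"
  have S: "0 < S"
    using a by (simp add: S_def add_pos_pos)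
  have p: "0 < p" "p \<le> 1 / 4"
    using a zero_le_power2[of "a - 1 / 2"] by (simp_all add: p_def power2_eq_square algebra_simps)
  have "2 powr (1 / \<beta> - 1) * (4 * p powr (2 - \<beta>)) \<le> S powr (1 / \<beta> - 2)"
  proof (cases "\<beta> \<le> 1 / 2")
    case True
    have "2 * p powr (\<beta> / 2) \<le> S"
    proof -
      have sq: "y powr \<beta> = (y powr (\<beta> / 2))\<^sup>2" for y :: real
        by (simp add: powr_half_sqrt_powr power2_eq_square flip: powr_add)
      have "p powr (\<beta> / 2) = a powr (\<beta> / 2) * (1 - a) powr (\<beta> / 2)"
        using a by (simp add: p_def powr_mult)
      then show ?thesis
        using sum_squares_bound[of "a powr (\<beta> / 2)" "(1 - a) powr (\<beta> / 2)"]
        unfolding S_def sq[of a] sq[of "1 - a"] by simp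
    qed
    then have "(2 * p powr (\<beta> / 2)) powr (1 / \<beta> - 2) \<le> S powr (1 / \<beta> - 2)"
      using True \<beta> p by (intro powr_mono2) (auto simp: field_simps)
    moreover have "(2 * p powr (\<beta> / 2)) powr (1 / \<beta> - 2) = 2 powr (1 / \<beta> - 2) * p powr (1 / 2 - \<beta>)"
    proof -
      have "\<beta> / 2 * (1 / \<beta> - 2) = 1 / 2 - \<beta>"
        using \<beta> by (simp add: field_simps)
      moreover have "(2 * p powr (\<beta> / 2)) powr (1 / \<beta> - 2)
          = 2 powr (1 / \<beta> - 2) * (p powr (\<beta> / 2)) powr (1 / \<beta> - 2)"
        by (intro powr_mult)
      ultimately show ?thesis
        by (simp only: powr_powr)
    qed
    \<comment> \<open>Factoring \<open>p powr (1 / 2 - \<beta>)\<close> out of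
      \<open>p powr (2 - \<beta>)\<close> leaves only \<open>8 * p powr (3 / 2) \<le> 1\<close>,
      which is free of \<open>\<beta>\<close>.\<close>
    moreover have "2 powr (1 / \<beta> - 1) * (4 * p powr (2 - \<beta>))
        \<le> 2 powr (1 / \<beta> - 2) * p powr (1 / 2 - \<beta>)"
    proof -
      have "p powr (3 / 2) \<le> (1 / 4) powr (3 / 2)"
        using p by (intro powr_mono2) auto
      also have "(1 / 4 :: real) powr (3 / 2) = 1 / 8"
        unfolding quarter_powr by (simp add: powr_minus)
      finally have "8 * p powr (3 / 2) \<le> 1"
        by simp
      then have "2 powr (1 / \<beta> - 2) * p powr (1 / 2 - \<beta>) * (8 * p powr (3 / 2))
          \<le> 2 powr (1 / \<beta> - 2) * p powr (1 / 2 - \<beta>)"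
        by (intro mult_left_le) auto
      moreover have "p powr (2 - \<beta>) = p powr (1 / 2 - \<beta>) * p powr (3 / 2)"
        by (simp flip: powr_add)
      moreover have "2 powr (1 / \<beta> - 1) = 2 powr (1 / \<beta> - 2) * (2 :: real)"
        using powr_add[of "2 :: real" "1 / \<beta> - 2" 1] by simp
      ultimately show ?thesis
        by simp
    qed
    ultimately show ?thesis
      by simp
  next
    case False
    \<comment> \<open>The factor two gives \<open>2 * a\<close> and \<open>2 * (1 - a)\<close> the
      mean \<open>1\<close>, the point of tangency, so the linear terms of
      \<open>powr_le_tangent\<close> cancel.\<close>
    have "2 powr \<beta> * S = (2 * a) powr \<beta> + (2 * (1 - a)) powr \<beta>"
    proof -
      have "(2 * a) powr \<beta> = 2 powr \<beta> * a powr \<beta>" "(2 * (1 - a)) powr \<beta> = 2 powr \<beta> * (1 - a) powr \<beta>"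
        using a by (intro powr_mult; simp)+
      then show ?thesis
        unfolding S_def distrib_left by linarith
    qed
    also have "\<dots> \<le> (1 + \<beta> * (2 * a - 1)) + (1 + \<beta> * (2 * (1 - a) - 1))"
      using a \<beta> by (intro add_mono powr_le_tangent) auto
    finally have "2 powr \<beta> * S \<le> 2"
      by (simp add: algebra_simps)
    then have "S \<le> 2 powr (1 - \<beta>)"
      by (simp add: powr_diff field_simps)
    then have "(2 powr (1 - \<beta>)) powr (1 / \<beta> - 2) \<le> S powr (1 / \<beta> - 2)"
      using S False \<beta> by (intro powr_mono2') (auto simp: field_simps)
    moreover have "p powr (2 - \<beta>) \<le> (1 / 4) powr (2 - \<beta>)"
      using p \<beta> by (intro powr_mono2) auto
    moreover have "2 powr (1 / \<beta> - 1) * (4 * (1 / 4) powr (2 - \<beta>)) = (2 powr (1 - \<beta>)) powr (1 / \<beta> - 2)"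
    proof -
      have "2 powr (1 / \<beta> - 1) * (4 * (1 / 4) powr (2 - \<beta>))
          = 2 powr ((1 / \<beta> - 1) + (2 + (- 2) * (2 - \<beta>)))"
        unfolding powr_add quarter_powr by simp
      also have "(1 / \<beta> - 1) + (2 + (- 2) * (2 - \<beta>)) = (1 - \<beta>) * (1 / \<beta> - 2)"
        using \<beta> by (simp add: field_simps)
      finally show ?thesis
        by (simp only: powr_powr)
    qed
    moreover have "2 powr (1 / \<beta> - 1) * (4 * p powr (2 - \<beta>))
        \<le> 2 powr (1 / \<beta> - 1) * (4 * (1 / 4) powr (2 - \<beta>))"
      using calculation(2) by (intro mult_left_mono) auto
    ultimately show ?thesis
      by simp
  qed
  then have "2 powr (1 / \<beta> - 1) * (4 * p powr (2 - \<beta>)) * S \<le> S powr (1 / \<beta> - 2) * S"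
    using S by (intro mult_right_mono) auto
  moreover have "S powr (1 / \<beta> - 2) * S = S powr (1 / \<beta> - 1)"
    using S powr_add[of S "1 / \<beta> - 2" 1] by simp
  ultimately show ?thesis
    by (simp add: p_def mult.assoc)
qed

text \<open>Multiplied by \<open>- (1 - \<beta>)\<close>, the right-hand side is the second
  derivative of the \<beta>-norm in direction \<open>b\<close>. Homogeneity makes the norm linear
  along \<open>x\<close>, so \<open>b\<close> may be replaced by \<open>d\<close>, which differs
  from it by a multiple of \<open>x\<close>. The signs of \<open>b\<close> then merge the classes
  into two.\<close>

lemma beta_norm_hessian:
  fixes x b :: "'a \<Rightarrow> real"
  assumes I: "finite I" and x: "\<And>j. j \<in> I \<Longrightarrow> 0 < x j" and sum_x: "sum x I = 1"
    and sum_b: "sum b I = 0" and \<beta>: "0 < \<beta>" "\<beta> < 1"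
  defines "S \<equiv> \<Sum>j\<in>I. x j powr \<beta>"
  shows "2 powr (1 / \<beta> - 1) * (\<Sum>j\<in>I. \<bar>b j\<bar>)\<^sup>2
    \<le> S powr (1 / \<beta> - 2) * (S * (\<Sum>j\<in>I. x j powr (\<beta> - 2) * (b j)\<^sup>2) - (\<Sum>j\<in>I. x j powr (\<beta> - 1) * b j)\<^sup>2)"
proof -
  have "I \<noteq> {}"
    using sum_x by auto
  then have S: "0 < S"
    unfolding S_def using I x by (intro sum_pos) (auto dest: x)
  define T where "T = (\<Sum>j\<in>I. x j powr (\<beta> - 1) * b j)"
  \<comment> \<open>\<open>\<tau>\<close> is the mean of \<open>b j / x j\<close> under weights
    proportional to \<open>x j powr \<beta>\<close>; subtracting it completes the square in
    \<open>SW\<close>.\<close>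
  define \<tau> where "\<tau> = T / S"
  define d where "d j = b j - \<tau> * x j" for j
  define W where "W = (\<Sum>j\<in>I. x j powr (\<beta> - 2) * (d j)\<^sup>2)"
  have W_nonneg: "0 \<le> W"
    unfolding W_def by (intro sum_nonneg) auto
  have SW: "S * (\<Sum>j\<in>I. x j powr (\<beta> - 2) * (b j)\<^sup>2) - T\<^sup>2 = S * W"
  proof -
    have "x j powr (\<beta> - 2) * (d j)\<^sup>2
        = x j powr (\<beta> - 2) * (b j)\<^sup>2 - 2 * \<tau> * (x j powr (\<beta> - 1) * b j) + \<tau>\<^sup>2 * x j powr \<beta>"
      if "j \<in> I" for j
    proof -
      have "x j powr (\<beta> - 1) = x j * x j powr (\<beta> - 2)" "x j powr \<beta> = x j * (x j * x j powr (\<beta> - 2))"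
        using x[OF that] by (simp_all add: powr_mult_base)
      then show ?thesis
        by (simp add: d_def power2_eq_square algebra_simps)
    qed
    then have "W = (\<Sum>j\<in>I. x j powr (\<beta> - 2) * (b j)\<^sup>2) - 2 * \<tau> * T + \<tau>\<^sup>2 * S"
      by (simp add: W_def T_def S_def sum.distrib sum_subtractf flip: sum_distrib_left)
    then show ?thesis
      using S by (simp add: \<tau>_def power2_eq_square field_simps)
  qed
  have "2 powr (1 / \<beta> - 1) * (\<Sum>j\<in>I. \<bar>b j\<bar>)\<^sup>2 \<le> S powr (1 / \<beta> - 1) * W"
  proof (cases "\<forall>j\<in>I. b j = 0")
    case True
    then show ?thesis
      using W_nonneg by simp
  next
    case False
    define A where "A = {j \<in> I. 0 \<le> b j}"
    define B where "B = {j \<in> I. b j < 0}"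
    have AB: "I = A \<union> B" "A \<inter> B = {}" "finite A" "finite B" "A \<subseteq> I" "B \<subseteq> I"
      using I by (auto simp: A_def B_def)
    have split: "sum g I = sum g A + sum g B" for g :: "'a \<Rightarrow> real"
      using AB by (simp add: sum.union_disjoint)
    have "A \<noteq> {}"
    proof
      assume "A = {}"
      then have "0 < sum (\<lambda>j. - b j) I"
        using I \<open>I \<noteq> {}\<close> by (intro sum_pos) (auto simp: A_def not_le)
      then show False
        using sum_b by (simp add: sum_negf)
    qed
    moreover have "B \<noteq> {}"
    proof
      assume "B = {}"
      then have "\<forall>j\<in>I. b j = 0"
        using sum_nonneg_eq_0_iff[OF I, of b] sum_b by (auto simp: B_def not_less)
      with False show False
        by simp
    qed
    moreover define a where "a = sum x A"
    ultimately have a: "0 < a" "a < 1"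
      using AB x sum_x split[of x] sum_pos[of A x] sum_pos[of B x] by auto
    have aB: "sum x B = 1 - a"
      using split[of x] sum_x by (simp add: a_def)
    \<comment> \<open>\<open>c\<close> is the sign vector of \<open>b\<close>, centred to have mean zero under \<open>x\<close>.\<close>
    define c where "c j = (if 0 \<le> b j then 2 * (1 - a) else - 2 * a)" for j
    have cA: "c j = 2 * (1 - a)" if "j \<in> A" for j
      using that by (simp add: c_def A_def)
    have cB: "c j = - 2 * a" if "j \<in> B" for j
      using that by (simp add: c_def B_def)
    have "(\<Sum>j\<in>I. c j * x j) = 0"
    proof -
      have "(\<Sum>j\<in>A. c j * x j) = (\<Sum>j\<in>A. 2 * (1 - a) * x j)"
        "(\<Sum>j\<in>B. c j * x j) = (\<Sum>j\<in>B. - 2 * a * x j)"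
        using cA cB by (intro sum.cong; simp)+
      then have "(\<Sum>j\<in>I. c j * x j) = 2 * (1 - a) * sum x A + - 2 * a * sum x B"
        unfolding split by (simp only: sum_distrib_left)
      then show ?thesis
        unfolding aB a_def[symmetric] by simp
    qed
    \<comment> \<open>\<open>c\<close> is the sign vector shifted by \<open>2 * a - 1\<close>, which
      does not matter against \<open>b\<close> of sum zero. Being centred, \<open>c\<close> also
      ignores the part \<open>\<tau> * x j\<close> of \<open>d j\<close>.\<close>
    moreover have "(\<Sum>j\<in>I. c j * b j) = (\<Sum>j\<in>I. \<bar>b j\<bar> - (2 * a - 1) * b j)"
      by (intro sum.cong) (auto simp: c_def algebra_simps)
    ultimately have cd: "(\<Sum>j\<in>I. c j * d j) = (\<Sum>j\<in>I. \<bar>b j\<bar>)"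
      using sum_b by (simp add: d_def right_diff_distrib sum_subtractf mult.left_commute[of _ \<tau>] flip: sum_distrib_left)
    define V where "V = (\<Sum>j\<in>I. x j powr (2 - \<beta>) * (c j)\<^sup>2)"
    \<comment> \<open>The two powers of \<open>x j\<close> are reciprocal, and their squares are the
      weights in \<open>V\<close> and \<open>W\<close>.\<close>
    have "(\<Sum>j\<in>I. \<bar>b j\<bar>)\<^sup>2
        = (\<Sum>j\<in>I. (x j powr (1 - \<beta> / 2) * c j) * (x j powr (\<beta> / 2 - 1) * d j))\<^sup>2"
    proof -
      have "x j powr (1 - \<beta> / 2) * x j powr (\<beta> / 2 - 1) = 1" if "j \<in> I" for j
        using x[OF that] by (simp flip: powr_add)
      then show ?thesis
        unfolding cd[symmetric] by (intro arg_cong[where f = "\<lambda>s. s\<^sup>2"] sum.cong) (auto simp: algebra_simps)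
    qed
    also have "\<dots> \<le> (\<Sum>j\<in>I. (x j powr (1 - \<beta> / 2) * c j)\<^sup>2) * (\<Sum>j\<in>I. (x j powr (\<beta> / 2 - 1) * d j)\<^sup>2)"
      by (rule Cauchy_Schwarz_ineq_sum)
    also have "\<dots> = V * W"
      by (simp add: V_def W_def power_mult_distrib power2_eq_square[of "_ powr _"] flip: powr_add)
    finally have CS: "(\<Sum>j\<in>I. \<bar>b j\<bar>)\<^sup>2 \<le> V * W" .
    define S2 where "S2 = a powr \<beta> + (1 - a) powr \<beta>"
    have "V = 4 * (1 - a)\<^sup>2 * (\<Sum>j\<in>A. x j powr (2 - \<beta>)) + 4 * a\<^sup>2 * (\<Sum>j\<in>B. x j powr (2 - \<beta>))"
    proof -
      have "(c j)\<^sup>2 = 4 * (1 - a)\<^sup>2" if "j \<in> A" for j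
        unfolding cA[OF that] power_mult_distrib by simp
      moreover have "(c j)\<^sup>2 = 4 * a\<^sup>2" if "j \<in> B" for j
        unfolding cB[OF that] power_mult_distrib by simp
      ultimately show ?thesis
        by (simp add: V_def split mult.commute flip: sum_distrib_right)
    qed
    \<comment> \<open>Merging \<open>A\<close> and \<open>B\<close> into single classes can only
      increase power sums with exponent \<open>2 - \<beta> \<ge> 1\<close>, and only decrease those
      with exponent \<open>\<beta>\<close>, whence \<open>S2 \<le> S\<close> below.\<close>
    also have "\<dots> \<le> 4 * (1 - a)\<^sup>2 * a powr (2 - \<beta>) + 4 * a\<^sup>2 * (1 - a) powr (2 - \<beta>)"
      using AB x \<beta> unfolding a_def aB[symmetric, unfolded a_def]
      by (intro add_mono mult_left_mono sum_powr_le_powr_sum) auto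
    also have "\<dots> = 4 * (a * (1 - a)) powr (2 - \<beta>) * S2"
    proof -
      have "y\<^sup>2 = y powr (2 - \<beta>) * y powr \<beta>" if "0 < y" for y :: real
        using that by (simp flip: powr_add)
      then have sq: "a\<^sup>2 = a powr (2 - \<beta>) * a powr \<beta>" "(1 - a)\<^sup>2 = (1 - a) powr (2 - \<beta>) * (1 - a) powr \<beta>"
        using a by simp_all
      have "(a * (1 - a)) powr (2 - \<beta>) = a powr (2 - \<beta>) * (1 - a) powr (2 - \<beta>)"
        by (rule powr_mult)
      then show ?thesis
        unfolding S2_def sq by (simp only: algebra_simps)
    qed
    finally have "2 powr (1 / \<beta> - 1) * V \<le> 2 powr (1 / \<beta> - 1) * (4 * (a * (1 - a)) powr (2 - \<beta>) * S2)"
      by (intro mult_left_mono) auto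
    also have "\<dots> \<le> S2 powr (1 / \<beta> - 1)"
      unfolding S2_def using a \<beta> by (rule two_point_norm_bound)
    also have "\<dots> \<le> S powr (1 / \<beta> - 1)"
    proof (rule powr_mono2)
      show "S2 \<le> S"
        unfolding S2_def S_def split aB[symmetric] unfolding a_def using AB x \<beta>
        by (intro add_mono powr_sum_le_sum_powr) auto
    qed (use \<beta> in \<open>auto simp: S2_def\<close>)
    finally have "2 powr (1 / \<beta> - 1) * V * W \<le> S powr (1 / \<beta> - 1) * W"
      using W_nonneg by (rule mult_right_mono)
    moreover have "2 powr (1 / \<beta> - 1) * (\<Sum>j\<in>I. \<bar>b j\<bar>)\<^sup>2 \<le> 2 powr (1 / \<beta> - 1) * (V * W)"
      using CS by (intro mult_left_mono) auto
    ultimately show ?thesis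
      unfolding mult.assoc by (rule order_trans[rotated])
  qed
  also have "S powr (1 / \<beta> - 1) * W = S powr (1 / \<beta> - 2) * (S * W)"
    using S powr_add[of S "1 / \<beta> - 2" 1] by simp
  finally show ?thesis
    using SW by (simp add: T_def)
qed

text \<open>The \<beta>-norm along the segment is compared with its tangent at \<open>q\<close>,
  with \<open>beta_norm_hessian\<close> supplying the curvature. By homogeneity the value and the
  slope at \<open>q\<close> combine through \<open>q j + b j = y j\<close> into the risk
  form.\<close>

lemma beta_norm_second_order:
  fixes q y :: "'a \<Rightarrow> real"
  assumes I: "finite I" and q: "\<And>j. j \<in> I \<Longrightarrow> 0 < q j" and y: "\<And>j. j \<in> I \<Longrightarrow> 0 \<le> y j"
    and sums: "sum q I = 1" "sum y I = 1" and \<beta>: "0 < \<beta>" "\<beta> < 1"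
  shows "(\<Sum>j\<in>I. y j powr \<beta>) powr (1 / \<beta>)
      + (1 - \<beta>) * 2 powr (1 / \<beta> - 1) / 2 * (\<Sum>j\<in>I. \<bar>y j - q j\<bar>)\<^sup>2
    \<le> (\<Sum>j\<in>I. q j powr \<beta>) powr (1 / \<beta> - 1) * (\<Sum>j\<in>I. q j powr (\<beta> - 1) * y j)"
proof -
  define b where "b j = y j - q j" for j
  define x where "x j t = q j + t * b j" for j and t :: real
  define S where "S t = (\<Sum>j\<in>I. x j t powr \<beta>)" for t
  define T where "T t = (\<Sum>j\<in>I. x j t powr (\<beta> - 1) * b j)" for t
  define U where "U t = (\<Sum>j\<in>I. x j t powr (\<beta> - 2) * (b j)\<^sup>2)" for t
  define K where "K = (1 - \<beta>) * 2 powr (1 / \<beta> - 1) * (\<Sum>j\<in>I. \<bar>b j\<bar>)\<^sup>2"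
  have "I \<noteq> {}"
    using sums by auto
  have sum_b: "sum b I = 0"
    using sums by (simp add: b_def sum_subtractf)
  have x_pos: "0 < x j t" if "j \<in> I" "0 \<le> t" "t < 1" for j t
    unfolding x_def b_def using that q y by (intro segment_bounds) auto
  have x_nonneg: "0 \<le> x j t" if "j \<in> I" "0 \<le> t" "t \<le> 1" for j t
    unfolding x_def b_def using that q y by (intro segment_bounds) auto
  have dx: "(x j has_real_derivative b j) (at t)" for j t
    unfolding x_def by (auto intro!: derivative_eq_intros)
  have "S 1 powr (1 / \<beta>) \<le> S 0 powr (1 / \<beta>) + S 0 powr (1 / \<beta> - 1) * T 0 - K / 2"
  proof (rule second_order_upper_bound)
    have "continuous_on {0..1} (x j)" for j
      unfolding x_def by (intro continuous_intros)
    \<comment> \<open>Both exponents \<open>\<beta>\<close> and \<open>1 / \<beta>\<close> are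
      positive, so the powers stay continuous where a coordinate vanishes at
      \<open>t = 1\<close>.\<close>
    then show "continuous_on {0..1} (\<lambda>t. S t powr (1 / \<beta>))"
      unfolding S_def using x_nonneg \<beta>
      by (intro continuous_on_powr' continuous_on_sum continuous_on_const)
        (auto intro!: sum_nonneg)
  next
    fix t :: real assume t: "0 \<le> t" "t < 1"
    have pos: "0 < x j t" if "j \<in> I" for j
      using x_pos[OF that t] .
    have S_pos: "0 < S t"
      unfolding S_def using I \<open>I \<noteq> {}\<close> pos by (intro sum_pos) (auto dest: pos)
    have dpowr: "((\<lambda>t. x j t powr r) has_real_derivative r * x j t powr (r - 1) * b j) (at t)"
      if "j \<in> I" for j r
      by (rule DERIV_chain2[OF has_real_derivative_powr[OF pos[OF that]] dx])
    have dS: "(S has_real_derivative \<beta> * T t) (at t)"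
      unfolding S_def T_def sum_distrib_left mult.assoc[symmetric] by (intro DERIV_sum dpowr)
    have "(T has_real_derivative (\<Sum>j\<in>I. (\<beta> - 1) * x j t powr (\<beta> - 1 - 1) * b j * b j)) (at t)"
      unfolding T_def by (intro DERIV_sum DERIV_cmult_right dpowr)
    then have dT: "(T has_real_derivative (\<beta> - 1) * U t) (at t)"
      by (simp add: U_def sum_distrib_left power2_eq_square mult.assoc)
    have "((\<lambda>t. S t powr (1 / \<beta>)) has_real_derivative 1 / \<beta> * S t powr (1 / \<beta> - 1) * (\<beta> * T t)) (at t)"
      by (rule DERIV_chain2[OF has_real_derivative_powr[OF S_pos] dS])
    then show "((\<lambda>t. S t powr (1 / \<beta>)) has_real_derivative S t powr (1 / \<beta> - 1) * T t) (at t)"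
      using \<beta> by simp
    show "((\<lambda>t. S t powr (1 / \<beta> - 1) * T t) has_real_derivative
        (1 / \<beta> - 1) * S t powr (1 / \<beta> - 1 - 1) * (\<beta> * T t) * T t
          + (\<beta> - 1) * U t * S t powr (1 / \<beta> - 1)) (at t)"
      by (rule DERIV_mult[OF DERIV_chain2[OF has_real_derivative_powr[OF S_pos] dS] dT])
    \<comment> \<open>Since \<open>(1 / \<beta> - 1) * \<beta> = 1 - \<beta>\<close>, both terms
      share this factor and the bracket of \<open>beta_norm_hessian\<close> appears.\<close>
    have "(1 / \<beta> - 1) * S t powr (1 / \<beta> - 1 - 1) * (\<beta> * T t) * T t
          + (\<beta> - 1) * U t * S t powr (1 / \<beta> - 1)
        = - (1 - \<beta>) * (S t powr (1 / \<beta> - 2) * (S t * U t - (T t)\<^sup>2))"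
    proof -
      have "S t powr (1 / \<beta> - 1) = S t powr (1 / \<beta> - 2) * S t"
        using S_pos powr_add[of "S t" "1 / \<beta> - 2" 1] by simp
      moreover have "1 / \<beta> - 1 - 1 = 1 / \<beta> - 2"
        by simp
      ultimately show ?thesis
        using \<beta> by (simp add: field_simps power2_eq_square)
    qed
    also have "\<dots> \<le> - K"
    proof -
      have "(\<Sum>j\<in>I. x j t) = 1"
        using sums sum_b by (simp add: x_def sum.distrib flip: sum_distrib_left)
      then have "2 powr (1 / \<beta> - 1) * (\<Sum>j\<in>I. \<bar>b j\<bar>)\<^sup>2 \<le> S t powr (1 / \<beta> - 2) * (S t * U t - (T t)\<^sup>2)"
        unfolding S_def T_def U_def using I pos sum_b \<beta> by (intro beta_norm_hessian) auto
      then show ?thesis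
        using \<beta> unfolding K_def mult.assoc mult_minus_left
        by (intro le_imp_neg_le mult_left_mono) auto
    qed
    finally show "(1 / \<beta> - 1) * S t powr (1 / \<beta> - 1 - 1) * (\<beta> * T t) * T t
          + (\<beta> - 1) * U t * S t powr (1 / \<beta> - 1) \<le> - K" .
  qed
  moreover have "S 0 powr (1 / \<beta>) + S 0 powr (1 / \<beta> - 1) * T 0
      = (\<Sum>j\<in>I. q j powr \<beta>) powr (1 / \<beta> - 1) * (\<Sum>j\<in>I. q j powr (\<beta> - 1) * y j)"
  proof -
    have S0: "0 < S 0"
      unfolding S_def using I \<open>I \<noteq> {}\<close> q by (intro sum_pos) (auto simp: x_def dest: q)
    have "S 0 powr (1 / \<beta>) = S 0 powr (1 / \<beta> - 1) * S 0"
      using S0 powr_add[of "S 0" "1 / \<beta> - 1" 1] by simp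
    then have "S 0 powr (1 / \<beta>) + S 0 powr (1 / \<beta> - 1) * T 0 = S 0 powr (1 / \<beta> - 1) * (S 0 + T 0)"
      by (simp add: distrib_left)
    also have "S 0 + T 0 = (\<Sum>j\<in>I. q j powr (\<beta> - 1) * y j)"
    proof -
      have "q j powr \<beta> = q j powr (\<beta> - 1) * q j" if "j \<in> I" for j
        using q[OF that] powr_mult_base[of "q j" "\<beta> - 1"] by (simp add: mult.commute)
      then show ?thesis
        by (simp add: S_def T_def x_def b_def algebra_simps flip: sum.distrib)
    qed
    finally show ?thesis
      by (simp add: S_def x_def)
  qed
  ultimately show ?thesis
    by (simp add: S_def x_def b_def K_def)
qed

section \<open>The simultaneous loss\<close>

text \<open>The second-order bounds require positive \<open>q\<close>. When \<open>q\<close>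
  dominates \<open>\<eta>\<close>, all sums can be restricted to the support of \<open>q\<close>,
  where this holds.\<close>

lemma simplex_support_sums:
  fixes \<eta> q :: "real ^ 'm::finite"
  assumes \<eta>: "\<eta> \<in> prob_simplex" and q: "q \<in> prob_simplex"
    and dom: "\<And>j. q $ j = 0 \<Longrightarrow> \<eta> $ j = 0"
  defines "I \<equiv> {j. 0 < q $ j}"
  shows "\<And>f. (\<And>j. q $ j = 0 \<Longrightarrow> f j = (0::real)) \<Longrightarrow> sum f UNIV = sum f I"
    and "(\<Sum>j\<in>I. q $ j) = 1" and "(\<Sum>j\<in>I. \<eta> $ j) = 1"
    and "(\<Sum>j\<in>I. \<bar>\<eta> $ j - q $ j\<bar>) = norm1 (\<eta> - q)"
proof -
  show *: "sum f UNIV = sum f I" if "\<And>j. q $ j = 0 \<Longrightarrow> f j = 0" for f :: "'m \<Rightarrow> real"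
    using that q unfolding I_def
    by (intro sum.mono_neutral_right) (auto simp: prob_simplex_def less_le)
  show "(\<Sum>j\<in>I. q $ j) = 1" "(\<Sum>j\<in>I. \<eta> $ j) = 1"
    using *[of "\<lambda>j. q $ j"] *[of "\<lambda>j. \<eta> $ j"] dom \<eta> q by (simp_all add: prob_simplex_def)
  show "(\<Sum>j\<in>I. \<bar>\<eta> $ j - q $ j\<bar>) = norm1 (\<eta> - q)"
    using *[of "\<lambda>j. \<bar>\<eta> $ j - q $ j\<bar>"] dom by (simp add: norm1_def)
qed

lemma simultaneous_loss_eq_infty: "q \<in> prob_simplex \<Longrightarrow> simultaneous_loss \<beta> j q = \<infinity> \<longleftrightarrow> q $ j = 0"
  by (auto simp: simultaneous_loss_def prob_simplex_def less_le)

lemma simplex_pos_coordinate: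
  assumes "q \<in> prob_simplex"
  obtains k where "0 < (q $ k :: real)"
proof -
  have "\<exists>k. 0 < q $ k"
  proof (rule ccontr)
    assume "\<nexists>k. 0 < q $ k"
    then have "(\<Sum>k\<in>UNIV. q $ k) \<le> 0"
      by (intro sum_nonpos) (auto simp: not_less)
    then show False
      using assms by (simp add: prob_simplex_def)
  qed
  then show thesis
    using that by blast
qed

lemma sum_powr_simplex_pos:
  fixes q :: "real ^ 'm::finite"
  assumes "q \<in> prob_simplex"
  shows "0 < (\<Sum>k\<in>UNIV. (q $ k) powr \<beta>)"
proof -
  obtain k where "0 < q $ k"
    using assms by (rule simplex_pos_coordinate)
  then show ?thesis
    by (intro sum_pos2[of UNIV k]) auto
qed

lemma powr_divide_beta_norm:
  fixes y :: real
  assumes "0 \<le> y" "0 < S" "0 < \<beta>"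
  shows "(y / S powr (1 / \<beta>)) powr (\<beta> - 1) = S powr (1 / \<beta> - 1) * y powr (\<beta> - 1)"
proof -
  have "1 / \<beta> * (\<beta> - 1) = - (1 / \<beta> - 1)"
    using assms by (simp add: field_simps)
  then have "(S powr (1 / \<beta>)) powr (\<beta> - 1) = S powr (- (1 / \<beta> - 1))"
    by (simp only: powr_powr)
  then show ?thesis
    using assms by (simp only: powr_divide powr_minus) (simp add: field_simps)
qed

lemma simultaneous_risk_bound:
  fixes \<eta> q :: "real ^ 'm::finite"
  assumes \<beta>: "0 < \<beta>" "\<beta> < 1" and \<eta>: "\<eta> \<in> prob_simplex" and q: "q \<in> prob_simplex"
  shows "risk (simultaneous_loss \<beta>) \<eta> \<eta> + ereal (kappa_lower \<beta> / 2 * (norm1 (\<eta> - q))\<^sup>2)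
    \<le> risk (simultaneous_loss \<beta>) \<eta> q"
proof (cases "\<exists>j. q $ j = 0 \<and> 0 < \<eta> $ j")
  case True
  then obtain j where "q $ j = 0" "0 < \<eta> $ j"
    by blast
  then have "risk (simultaneous_loss \<beta>) \<eta> q = \<infinity>"
    using simultaneous_loss_eq_infty[OF q] by (intro risk_not_dominated) auto
  then show ?thesis
    by simp
next
  case False
  then have dom: "\<eta> $ j = 0" if "q $ j = 0" for j
    using that \<eta> by (auto simp: prob_simplex_def less_le)
  define I where "I = {j. 0 < q $ j}"
  note supp = simplex_support_sums[OF \<eta> q dom, folded I_def]
  define N where "N = (\<Sum>j\<in>UNIV. (\<eta> $ j) powr \<beta>)"
  define S where "S = (\<Sum>j\<in>UNIV. (q $ j) powr \<beta>)"
  have pos: "0 < N" "0 < S"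
    unfolding N_def S_def using \<eta> q by (intro sum_powr_simplex_pos; simp)+
  have nonneg: "0 \<le> \<eta> $ j" "0 \<le> q $ j" for j
    using \<eta> q by (auto simp: prob_simplex_def)
  have "risk (simultaneous_loss \<beta>) \<eta> \<eta>
      = ereal (\<Sum>j\<in>UNIV. \<eta> $ j * (\<eta> $ j / beta_norm \<beta> \<eta>) powr (\<beta> - 1))"
    using \<eta> by (rule risk_dominated) (simp add: simultaneous_loss_def)
  also have "(\<Sum>j\<in>UNIV. \<eta> $ j * (\<eta> $ j / beta_norm \<beta> \<eta>) powr (\<beta> - 1))
      = (\<Sum>j\<in>UNIV. N powr (1 / \<beta> - 1) * (\<eta> $ j) powr \<beta>)"
    using nonneg pos \<beta> powr_mult_base[OF nonneg(1), of _ "\<beta> - 1"]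
    by (intro sum.cong) (auto simp: beta_norm_def powr_divide_beta_norm simp flip: N_def)
  also have "\<dots> = N powr (1 / \<beta>)"
    using pos powr_add[of N "1 / \<beta> - 1" 1] by (simp flip: N_def sum_distrib_left)
  finally have risk_\<eta>: "risk (simultaneous_loss \<beta>) \<eta> \<eta> = ereal (N powr (1 / \<beta>))" .
  have "risk (simultaneous_loss \<beta>) \<eta> q
      = ereal (\<Sum>j\<in>UNIV. \<eta> $ j * (q $ j / beta_norm \<beta> q) powr (\<beta> - 1))"
    using \<eta>
  proof (rule risk_dominated)
    fix j assume "0 < \<eta> $ j"
    then have "0 < q $ j"
      using dom[of j] nonneg(2)[of j] by (cases "q $ j = 0") auto
    then show "simultaneous_loss \<beta> j q = ereal ((q $ j / beta_norm \<beta> q) powr (\<beta> - 1))"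
      by (simp add: simultaneous_loss_def)
  qed
  also have "(\<Sum>j\<in>UNIV. \<eta> $ j * (q $ j / beta_norm \<beta> q) powr (\<beta> - 1))
      = (\<Sum>j\<in>UNIV. S powr (1 / \<beta> - 1) * ((q $ j) powr (\<beta> - 1) * \<eta> $ j))"
    using nonneg pos \<beta>
    by (intro sum.cong) (auto simp: beta_norm_def powr_divide_beta_norm simp flip: S_def)
  also have "\<dots> = S powr (1 / \<beta> - 1) * (\<Sum>j\<in>I. (q $ j) powr (\<beta> - 1) * \<eta> $ j)"
    by (subst supp(1)) (auto simp: sum_distrib_left)
  finally have risk_q: "risk (simultaneous_loss \<beta>) \<eta> q
      = ereal (S powr (1 / \<beta> - 1) * (\<Sum>j\<in>I. (q $ j) powr (\<beta> - 1) * \<eta> $ j))" .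
  have "(\<Sum>j\<in>I. (\<eta> $ j) powr \<beta>) powr (1 / \<beta>)
      + (1 - \<beta>) * 2 powr (1 / \<beta> - 1) / 2 * (\<Sum>j\<in>I. \<bar>\<eta> $ j - q $ j\<bar>)\<^sup>2
    \<le> (\<Sum>j\<in>I. (q $ j) powr \<beta>) powr (1 / \<beta> - 1) * (\<Sum>j\<in>I. (q $ j) powr (\<beta> - 1) * \<eta> $ j)"
    using nonneg supp \<beta> by (intro beta_norm_second_order) (auto simp: I_def)
  moreover have "(\<Sum>j\<in>I. (\<eta> $ j) powr \<beta>) = N" "(\<Sum>j\<in>I. (q $ j) powr \<beta>) = S"
    unfolding N_def S_def using dom by (intro supp(1)[symmetric]; simp)+
  ultimately show ?thesis
    by (simp add: risk_\<eta> risk_q supp kappa_lower_def)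
qed

lemma kappa_lower_pos: "\<beta> < 1 \<Longrightarrow> 0 < kappa_lower \<beta>"
  by (simp add: kappa_lower_def)

lemma kappa_upper_pos: "\<beta> < 1 \<Longrightarrow> 0 < m \<Longrightarrow> 0 < kappa_upper m \<beta>"
  by (simp add: kappa_upper_def)

text \<open>For \<open>\<beta> \<ge> 1 / 2\<close> the exponent of \<open>m\<close> is nonpositive,
  so the constant is largest at \<open>m = 2\<close>, where it coincides with
  \<open>kappa_lower \<beta>\<close>.\<close>

lemma kappa_upper_le_kappa_lower:
  assumes \<beta>: "1 / 2 \<le> \<beta>" "\<beta> < 1" and m: "2 \<le> m"
  shows "kappa_upper m \<beta> \<le> kappa_lower \<beta>"
proof -
  let ?e = "(1 - 1 / \<beta>) * (2 * \<beta> - 1)"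
  have "?e \<le> 0"
    using \<beta> by (intro mult_nonpos_nonneg) auto
  then have "real m powr ?e \<le> 2 powr ?e"
    using m by (intro powr_mono2') auto
  then have "kappa_upper m \<beta> \<le> (1 - \<beta>) * 2 powr ?e * 2 powr (2 - 2 * \<beta>)"
    using \<beta> unfolding kappa_upper_def by (intro mult_right_mono mult_left_mono) auto
  also have "\<dots> = (1 - \<beta>) * 2 powr (?e + (2 - 2 * \<beta>))"
    by (simp only: powr_add mult.assoc)
  also have "?e + (2 - 2 * \<beta>) = 1 / \<beta> - 1"
    using \<beta> by (simp add: field_simps)
  finally show ?thesis
    by (simp add: kappa_lower_def)
qed

lemma simultaneous_regret_bounds:
  fixes am :: "real ^ 'm::finite \<Rightarrow> 'm"
  assumes am: "argmax_selector am" and \<beta>: "0 < \<beta>" "\<beta> < 1" and \<kappa>: "0 \<le> \<kappa>" "\<kappa> \<le> kappa_lower \<beta>"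
  shows "proper_scoring_rule (simultaneous_loss \<beta> :: 'm \<Rightarrow> real ^ 'm \<Rightarrow> ereal) \<and>
    bregman_regret_bound \<kappa> (simultaneous_loss \<beta> :: 'm \<Rightarrow> real ^ 'm \<Rightarrow> ereal) \<and>
    zero_one_regret_bound am \<kappa> (simultaneous_loss \<beta>)"
  using am \<kappa>(1)
proof (rule regret_bounds_of_risk_bound)
  fix \<eta> q :: "real ^ 'm" assume *: "\<eta> \<in> prob_simplex" "q \<in> prob_simplex"
  have "\<kappa> / 2 * (norm1 (\<eta> - q))\<^sup>2 \<le> kappa_lower \<beta> / 2 * (norm1 (\<eta> - q))\<^sup>2"
    using \<kappa> by (intro mult_right_mono) auto
  then have "risk (simultaneous_loss \<beta>) \<eta> \<eta> + ereal (\<kappa> / 2 * (norm1 (\<eta> - q))\<^sup>2)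
      \<le> risk (simultaneous_loss \<beta>) \<eta> \<eta> + ereal (kappa_lower \<beta> / 2 * (norm1 (\<eta> - q))\<^sup>2)"
    by (intro add_left_mono) simp
  also have "\<dots> \<le> risk (simultaneous_loss \<beta>) \<eta> q"
    by (rule simultaneous_risk_bound[OF \<beta> *])
  finally show "risk (simultaneous_loss \<beta>) \<eta> \<eta> + ereal (\<kappa> / 2 * (norm1 (\<eta> - q))\<^sup>2)
      \<le> risk (simultaneous_loss \<beta>) \<eta> q" .
qed (rule simultaneous_loss_eq_infty)

section \<open>The pairwise loss\<close>

text \<open>For two classes with normalised mass \<open>y\<close>, the risk \<open>h\<close> of the
  action \<open>t\<close> has derivative \<open>2 * s t * (t - y)\<close>, so a nonnegative weight
  makes it minimal at \<open>t = y\<close>. The ratio \<open>1\<close> lies outside the range of the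
  derivative hypothesis; where it matters, \<open>a\<close> or \<open>b\<close> is zero and
  \<open>one\<close> covers it.\<close>

lemma pair_comparison:
  fixes d s :: "real \<Rightarrow> real"
  assumes d: "\<And>x. 0 < x \<Longrightarrow> x < 1 \<Longrightarrow> (d has_real_derivative - 2 * (1 - x) * s x) (at x)"
    and s: "\<And>x. 0 < x \<Longrightarrow> x < 1 \<Longrightarrow> 0 \<le> s x" "\<And>x. s (1 - x) = s x"
    and one: "\<And>x. a = 0 \<or> b = 0 \<Longrightarrow> 0 < x \<Longrightarrow> x < 1 \<Longrightarrow> d 1 \<le> d x"
    and nonneg: "0 \<le> a" "0 \<le> b" "0 \<le> p" "0 \<le> r"
    and dom: "p = 0 \<Longrightarrow> a = 0" "r = 0 \<Longrightarrow> b = 0"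
  shows "a * d (a / (a + b)) + b * d (b / (a + b)) \<le> a * d (p / (p + r)) + b * d (r / (p + r))"
proof -
  have one_sided: "u * d 1 \<le> u * d (v / (v + v'))"
    if "a = 0 \<or> b = 0" "0 \<le> u" "0 < v" "0 \<le> v'" for u v v'
  proof (cases "v' = 0")
    case False
    with that one[OF that(1), of "v / (v + v')"] show ?thesis
      by (intro mult_left_mono) auto
  qed (use that in auto)
  consider "a = 0" "b = 0" | "0 < a" "b = 0" | "a = 0" "0 < b" | "0 < a" "0 < b"
    using nonneg by fastforce
  then show ?thesis
  proof cases
    case 1
    then show ?thesis
      by simp
  next
    case 2
    then have "0 < p"
      using dom nonneg by (cases "p = 0") auto
    then show ?thesis
      using 2 one_sided[of a p r] nonneg by simp
  next
    case 3
    then have "0 < r"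
      using dom nonneg by (cases "r = 0") auto
    then show ?thesis
      using 3 one_sided[of b r p] nonneg by (simp add: add.commute)
  next
    case 4
    then have pr: "0 < p" "0 < r"
      using dom nonneg by (auto simp: less_le)
    define y where "y = a / (a + b)"
    define x where "x = p / (p + r)"
    have xy: "0 < x" "x < 1" "0 < y" "y < 1"
      using 4 pr by (auto simp: x_def y_def)
    have compl: "b / (a + b) = 1 - y" "r / (p + r) = 1 - x"
      using 4 pr by (simp_all add: x_def y_def field_simps)
    have ab: "a = (a + b) * y" "b = (a + b) * (1 - y)"
      using 4 by (simp_all add: y_def field_simps)
    define h where "h t = y * d t + (1 - y) * d (1 - t)" for t
    have dh: "(h has_real_derivative 2 * s t * (t - y)) (at t)" if t: "0 < t" "t < 1" for t
    proof -
      have "((\<lambda>t. d (1 - t)) has_real_derivative - 2 * (1 - (1 - t)) * s (1 - t) * - 1) (at t)"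
        by (rule DERIV_chain2[OF d]) (use t in \<open>auto intro!: derivative_eq_intros\<close>)
      then have "(h has_real_derivative
          y * (- 2 * (1 - t) * s t) + (1 - y) * (- 2 * (1 - (1 - t)) * s (1 - t) * - 1)) (at t)"
        unfolding h_def using t by (intro DERIV_add DERIV_cmult d)
      then show ?thesis
        by (rule DERIV_cong) (simp add: s(2) algebra_simps)
    qed
    have "h y \<le> h x"
    proof (cases "y \<le> x")
      case True
      then show ?thesis
      proof (rule DERIV_nonneg_imp_nondecreasing)
        fix t assume t: "y \<le> t" "t \<le> x"
        then show "\<exists>z. (h has_real_derivative z) (at t) \<and> 0 \<le> z"
          using dh[of t] s(1)[of t] xy by (intro exI[of _ "2 * s t * (t - y)"]) auto
      qed
    next
      case False
      then have "x \<le> y"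
        by simp
      then show ?thesis
      proof (rule DERIV_nonpos_imp_nonincreasing)
        fix t assume t: "x \<le> t" "t \<le> y"
        then show "\<exists>z. (h has_real_derivative z) (at t) \<and> z \<le> 0"
          using dh[of t] s(1)[of t] xy
          by (intro exI[of _ "2 * s t * (t - y)"]) (auto intro!: mult_nonneg_nonpos)
      qed
    qed
    then have "(a + b) * h y \<le> (a + b) * h x"
      using 4 by (intro mult_left_mono) auto
    moreover have "(a + b) * h t = a * d t + b * d (1 - t)" for t
      unfolding h_def distrib_left mult.assoc[symmetric] ab[symmetric] ..
    ultimately show ?thesis
      unfolding compl by (simp flip: y_def x_def)
  qed
qed

text \<open>The loss splits as \<open>\<l> x = d x - 2 * ln x\<close>, where the logarithmic term
  carries the weight \<open>1 / (x * (1 - x))\<close> and \<open>d\<close> the nonnegative excess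
  \<open>s\<close>. By \<open>pair_comparison\<close> the part \<open>d\<close> has nonnegative
  regret, so the quadratic term can be taken from the logarithm, whose factor \<open>2\<close>
  doubles \<open>pairwise_log_bound\<close>.\<close>

lemma pairwise_real_bound:
  fixes \<eta> q :: "real ^ 'm::finite" and \<l> w :: "real \<Rightarrow> real"
  assumes \<l>: "\<And>x. 0 < x \<Longrightarrow> x < 1 \<Longrightarrow> (\<l> has_real_derivative - 2 * (1 - x) * w x) (at x)"
    and w: "\<And>x. 0 < x \<Longrightarrow> x < 1 \<Longrightarrow> 1 / (x * (1 - x)) \<le> w x" "\<And>x. w (1 - x) = w x"
    and one: "\<And>j x. \<eta> $ j = 0 \<Longrightarrow> 0 < x \<Longrightarrow> x < 1 \<Longrightarrow> \<l> 1 \<le> \<l> x + 2 * ln x"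
    and \<eta>: "\<eta> \<in> prob_simplex" and q: "q \<in> prob_simplex"
    and dom: "\<And>j. q $ j = 0 \<Longrightarrow> \<eta> $ j = 0"
  shows "(\<Sum>j\<in>UNIV. \<eta> $ j * (\<Sum>k\<in>UNIV - {j}. \<l> (\<eta> $ j / (\<eta> $ j + \<eta> $ k)))) + (norm1 (\<eta> - q))\<^sup>2
    \<le> (\<Sum>j\<in>UNIV. \<eta> $ j * (\<Sum>k\<in>UNIV - {j}. \<l> (q $ j / (q $ j + q $ k))))"
proof -
  define d where "d x = \<l> x + 2 * ln x" for x
  define s where "s x = w x - 1 / (x * (1 - x))" for x
  define R where "R v j k = v $ j / (v $ j + v $ k)" for v :: "real ^ 'm" and j k
  have nonneg: "0 \<le> \<eta> $ j" "0 \<le> q $ j" for j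
    using \<eta> q by (auto simp: prob_simplex_def)
  have q_pos: "0 < q $ j" if "\<eta> $ j \<noteq> 0" for j
    using that dom[of j] nonneg(2)[of j] by (cases "q $ j = 0") auto
  have d_deriv: "(d has_real_derivative - 2 * (1 - x) * s x) (at x)" if "0 < x" "x < 1" for x
    unfolding d_def using that
    by (auto intro!: derivative_eq_intros \<l> simp: s_def field_simps)
  have pair: "\<eta> $ j * d (R \<eta> j k) + \<eta> $ k * d (R \<eta> k j) \<le> \<eta> $ j * d (R q j k) + \<eta> $ k * d (R q k j)" for j k
    unfolding R_def add.commute[of "_ $ k" "_ $ j"]
  proof (rule pair_comparison[OF d_deriv])
    show "0 \<le> s x" if "0 < x" "x < 1" for x
      using w(1)[OF that] by (simp add: s_def)
    show "s (1 - x) = s x" for x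
      using w(2)[of x] by (simp add: s_def mult.commute)
    show "d 1 \<le> d x" if "\<eta> $ j = 0 \<or> \<eta> $ k = 0" "0 < x" "x < 1" for x
      using that one[of j x] one[of k x] by (auto simp: d_def)
  qed (use nonneg dom in auto)
  have d_le: "(\<Sum>j\<in>UNIV. \<Sum>k\<in>UNIV. \<eta> $ j * d (R \<eta> j k)) \<le> (\<Sum>j\<in>UNIV. \<Sum>k\<in>UNIV. \<eta> $ j * d (R q j k))"
  proof -
    have sym: "2 * (\<Sum>j\<in>UNIV. \<Sum>k\<in>UNIV. \<eta> $ j * d (R v j k))
        = (\<Sum>j\<in>UNIV. \<Sum>k\<in>UNIV. \<eta> $ j * d (R v j k) + \<eta> $ k * d (R v k j))" for v
    proof -
      have "(\<Sum>j\<in>UNIV. \<Sum>k\<in>UNIV. \<eta> $ k * d (R v k j)) = (\<Sum>j\<in>UNIV. \<Sum>k\<in>UNIV. \<eta> $ j * d (R v j k))"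
        by (rule sum.swap)
      then show ?thesis
        by (simp add: sum.distrib)
    qed
    have "2 * (\<Sum>j\<in>UNIV. \<Sum>k\<in>UNIV. \<eta> $ j * d (R \<eta> j k)) \<le> 2 * (\<Sum>j\<in>UNIV. \<Sum>k\<in>UNIV. \<eta> $ j * d (R q j k))"
      unfolding sym by (intro sum_mono pair)
    then show ?thesis
      by simp
  qed
  define I where "I = {j. 0 < q $ j}"
  note supp = simplex_support_sums[OF \<eta> q dom, folded I_def]
  \<comment> \<open>Rows with \<open>\<eta> $ j = 0\<close> vanish; in the others,
    \<open>v $ k = 0\<close> gives the ratio \<open>1\<close> and \<open>ln 1 = 0\<close>. So both
    indices can be restricted to \<open>I\<close>.\<close>
  have log_sum: "(\<Sum>j\<in>UNIV. \<Sum>k\<in>UNIV. \<eta> $ j * - ln (R v j k))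
      = (\<Sum>j\<in>I. \<Sum>k\<in>I. \<eta> $ j * (ln (v $ j + v $ k) - ln (v $ j)))"
    if v: "\<And>j. 0 \<le> v $ j" "\<And>j. \<eta> $ j \<noteq> 0 \<Longrightarrow> 0 < v $ j" "\<And>j. q $ j = 0 \<Longrightarrow> v $ j = 0" for v
  proof -
    have "(\<Sum>j\<in>UNIV. \<Sum>k\<in>UNIV. \<eta> $ j * - ln (R v j k)) = (\<Sum>j\<in>I. \<Sum>k\<in>UNIV. \<eta> $ j * - ln (R v j k))"
      using dom by (intro supp(1)) auto
    also have "\<dots> = (\<Sum>j\<in>I. \<Sum>k\<in>I. \<eta> $ j * - ln (R v j k))"
    proof (rule sum.cong[OF refl], rule supp(1))
      fix j k assume "j \<in> I" "q $ k = 0"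
      then show "\<eta> $ j * - ln (R v j k) = 0"
        using v(2)[of j] v(3)[of k] by (cases "\<eta> $ j = 0") (auto simp: R_def)
    qed
    also have "\<dots> = (\<Sum>j\<in>I. \<Sum>k\<in>I. \<eta> $ j * (ln (v $ j + v $ k) - ln (v $ j)))"
    proof (intro sum.cong refl)
      fix j k
      show "\<eta> $ j * - ln (R v j k) = \<eta> $ j * (ln (v $ j + v $ k) - ln (v $ j))"
      proof (cases "\<eta> $ j = 0")
        case False
        then have "0 < v $ j" "0 < v $ j + v $ k"
          using v(2)[of j] v(1)[of k] by auto
        then show ?thesis
          by (simp add: R_def ln_div)
      qed simp
    qed
    finally show ?thesis .
  qed
  have "(\<Sum>j\<in>I. \<Sum>k\<in>I. \<eta> $ j * (ln (\<eta> $ j + \<eta> $ k) - ln (\<eta> $ j)))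
      + (\<Sum>j\<in>I. \<bar>\<eta> $ j - q $ j\<bar>)\<^sup>2 / 2
    \<le> (\<Sum>j\<in>I. \<Sum>k\<in>I. \<eta> $ j * (ln (q $ j + q $ k) - ln (q $ j)))"
    using nonneg supp by (intro pairwise_log_bound) (auto simp: I_def)
  also have "(\<Sum>j\<in>I. \<Sum>k\<in>I. \<eta> $ j * (ln (\<eta> $ j + \<eta> $ k) - ln (\<eta> $ j)))
      = (\<Sum>j\<in>UNIV. \<Sum>k\<in>UNIV. \<eta> $ j * - ln (R \<eta> j k))"
    using nonneg dom by (intro log_sum[symmetric]) (auto simp: less_le)
  also have "(\<Sum>j\<in>I. \<Sum>k\<in>I. \<eta> $ j * (ln (q $ j + q $ k) - ln (q $ j)))
      = (\<Sum>j\<in>UNIV. \<Sum>k\<in>UNIV. \<eta> $ j * - ln (R q j k))"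
    using nonneg q_pos by (intro log_sum[symmetric]) auto
  finally have log_le: "(\<Sum>j\<in>UNIV. \<Sum>k\<in>UNIV. \<eta> $ j * - ln (R \<eta> j k)) + (norm1 (\<eta> - q))\<^sup>2 / 2
      \<le> (\<Sum>j\<in>UNIV. \<Sum>k\<in>UNIV. \<eta> $ j * - ln (R q j k))"
    by (simp add: supp)
  have full: "(\<Sum>j\<in>UNIV. \<Sum>k\<in>UNIV. \<eta> $ j * \<l> (R v j k))
      = (\<Sum>j\<in>UNIV. \<Sum>k\<in>UNIV. \<eta> $ j * d (R v j k)) + 2 * (\<Sum>j\<in>UNIV. \<Sum>k\<in>UNIV. \<eta> $ j * - ln (R v j k))" for v
    by (simp add: d_def sum_distrib_left algebra_simps flip: sum.distrib)
  \<comment> \<open>Including \<open>k = j\<close> adds \<open>\<l> (1 / 2)\<close> to each row,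
    weighted by \<open>\<eta>\<close>, hence the same amount for \<open>v = \<eta>\<close> and
    \<open>v = q\<close>.\<close>
  have diag: "(\<Sum>j\<in>UNIV. \<eta> $ j * (\<Sum>k\<in>UNIV - {j}. \<l> (R v j k)))
      = (\<Sum>j\<in>UNIV. \<Sum>k\<in>UNIV. \<eta> $ j * \<l> (R v j k)) - (\<Sum>j\<in>UNIV. \<eta> $ j * \<l> (1 / 2))"
    if v: "\<And>j. \<eta> $ j \<noteq> 0 \<Longrightarrow> 0 < v $ j" for v
  proof -
    have "\<eta> $ j * (\<Sum>k\<in>UNIV - {j}. \<l> (R v j k)) = (\<Sum>k\<in>UNIV. \<eta> $ j * \<l> (R v j k)) - \<eta> $ j * \<l> (1 / 2)" for j
    proof (cases "\<eta> $ j = 0")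
      case False
      then have half: "R v j j = 1 / 2"
        using v[of j] by (simp add: R_def field_simps)
      have "(\<Sum>k\<in>UNIV. \<l> (R v j k)) = \<l> (1 / 2) + (\<Sum>k\<in>UNIV - {j}. \<l> (R v j k))"
        using sum.remove[of UNIV j "\<lambda>k. \<l> (R v j k)"] unfolding half by simp
      then show ?thesis
        by (simp add: algebra_simps flip: sum_distrib_left)
    qed simp
    then show ?thesis
      by (simp add: sum_subtractf)
  qed
  have "(\<Sum>j\<in>UNIV. \<eta> $ j * (\<Sum>k\<in>UNIV - {j}. \<l> (R \<eta> j k))) + (norm1 (\<eta> - q))\<^sup>2
      \<le> (\<Sum>j\<in>UNIV. \<eta> $ j * (\<Sum>k\<in>UNIV - {j}. \<l> (R q j k)))"
    using d_le log_le nonneg q_pos full[of \<eta>] full[of q] diag[of \<eta>] diag[of q]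
    by (simp add: less_le)
  then show ?thesis
    by (simp add: R_def)
qed

section \<open>One-variable form of the pairwise loss and its boundary limits\<close>

lemma two_class_derivatives:
  assumes weight: "two_class_weight f0 w" and x: "0 < x" "x < 1"
  defines "g1 \<equiv> \<lambda>u. - deriv f0 u" and "g2 \<equiv> \<lambda>u. u * deriv f0 u - f0 u"
  shows "((\<lambda>t. g1 (t / (1 - t))) has_real_derivative - (1 - x) * w x) (at x)"
    and "((\<lambda>t. g2 (t / (1 - t))) has_real_derivative x * w x) (at x)"
proof -
  have deriv: "((\<lambda>t. two_class_loss f0 j (vector [t, 1 - t])) has_real_derivative
      - (of_bool (j = 1) - x) * w x) (at x)" for j
    using weight x unfolding two_class_weight_def by simp
  have "two_class_loss f0 1 (vector [t, 1 - t]) = g1 (t / (1 - t))"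
    "two_class_loss f0 2 (vector [t, 1 - t]) = g2 (t / (1 - t))" for t
    by (simp_all add: two_class_loss_def g1_def g2_def Let_def)
  then show "((\<lambda>t. g1 (t / (1 - t))) has_real_derivative - (1 - x) * w x) (at x)"
    "((\<lambda>t. g2 (t / (1 - t))) has_real_derivative x * w x) (at x)"
    using deriv[of 1] deriv[of 2] by simp_all
qed

text \<open>With the infimum taken in \<open>ereal\<close>, the limit exists also for functions
  unbounded below, as occurs in the pairwise loss for \<open>\<nu> \<le> -1\<close>.\<close>

lemma antimono_tendsto_at_left:
  fixes f :: "real \<Rightarrow> ereal"
  assumes "a < b" and mono: "\<And>x y. a < x \<Longrightarrow> x \<le> y \<Longrightarrow> y < b \<Longrightarrow> f y \<le> f x"
  shows "(f \<longlongrightarrow> (INF x\<in>{a<..<b}. f x)) (at_left b)"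
proof (rule order_tendstoI)
  fix l assume l: "l < (INF x\<in>{a<..<b}. f x)"
  have "\<forall>\<^sub>F x in at_left b. x \<in> {a<..<b}"
    using \<open>a < b\<close> by (rule eventually_at_left_real)
  then show "\<forall>\<^sub>F x in at_left b. l < f x"
  proof eventually_elim
    case (elim x)
    then have "(INF x\<in>{a<..<b}. f x) \<le> f x"
      by (rule INF_lower)
    with l show ?case
      by (rule less_le_trans)
  qed
next
  fix u assume "(INF x\<in>{a<..<b}. f x) < u"
  then obtain z where z: "z \<in> {a<..<b}" "f z < u"
    by (auto simp: INF_less_iff)
  then have "\<forall>\<^sub>F x in at_left b. x \<in> {z<..<b}"
    by (intro eventually_at_left_real) auto
  then show "\<forall>\<^sub>F x in at_left b. f x < u"
  proof eventually_elim
    case (elim x)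
    then have "f x \<le> f z"
      using z by (intro mono) auto
    then show ?case
      using z(2) by (rule le_less_trans)
  qed
qed

text \<open>By the symmetry of the weight, the two summands of the pairwise loss agree up to a constant
  as functions of \<open>t = q\<^sub>j / (q\<^sub>j + q\<^sub>k)\<close>. The number \<open>\<l> 1\<close> is meaningful only if the limit \<open>A\<close>
  at \<open>q\<^sub>k = 0\<close> is finite.\<close>

lemma pairwise_loss_representation:
  assumes weight: "two_class_weight f0 w"
    and w: "\<And>x. 0 < x \<Longrightarrow> x < 1 \<Longrightarrow> 1 / (x * (1 - x)) \<le> w x" "\<And>x. w (1 - x) = w x"
  obtains \<l> :: "real \<Rightarrow> real" and A :: ereal where
    "\<And>x. 0 < x \<Longrightarrow> x < 1 \<Longrightarrow> (\<l> has_real_derivative - 2 * (1 - x) * w x) (at x)"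
    "A = -\<infinity> \<or> A = ereal (\<l> 1)"
    "\<And>x. 0 < x \<Longrightarrow> x < 1 \<Longrightarrow> A \<le> ereal (\<l> x + 2 * ln x)"
    "\<And>(q :: real ^ 'm::finite) j. q \<in> prob_simplex \<Longrightarrow> 0 < q $ j \<Longrightarrow> pairwise_loss f0 j q =
      (\<Sum>k\<in>UNIV - {j}. if 0 < q $ k then ereal (\<l> (q $ j / (q $ j + q $ k))) else A)"
    "\<And>(q :: real ^ 'm::finite) j. q \<in> prob_simplex \<Longrightarrow> q $ j = 0 \<Longrightarrow> pairwise_loss f0 j q = \<infinity>"
proof -
  define g1 where "g1 u = - deriv f0 u" for u
  define g2 where "g2 u = u * deriv f0 u - f0 u" for u
  define G1 where "G1 t = g1 (t / (1 - t))" for t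
  define G2 where "G2 t = g2 (t / (1 - t))" for t
  have dG1: "(G1 has_real_derivative - (1 - x) * w x) (at x)"
    and dG2: "(G2 has_real_derivative x * w x) (at x)" if "0 < x" "x < 1" for x
    using two_class_derivatives[OF weight that] unfolding G1_def G2_def g1_def g2_def by simp_all
  define C where "C = G2 (1 / 2) - G1 (1 / 2)"
  have G2: "G2 (1 - t) = G1 t + C" if t: "0 < t" "t < 1" for t
  proof -
    have "G2 (1 - t) - G1 t = G2 (1 - 1 / 2) - G1 (1 / 2)"
    proof (rule DERIV_isconst3[where a = 0 and b = 1 and f = "\<lambda>t. G2 (1 - t) - G1 t"])
      fix x :: real assume x: "x \<in> {0<..<1}"
      have "((\<lambda>t. G2 (1 - t)) has_real_derivative (1 - x) * w (1 - x) * - 1) (at x)"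
        by (rule DERIV_chain2[OF dG2]) (use x in \<open>auto intro!: derivative_eq_intros\<close>)
      then have "((\<lambda>t. G2 (1 - t) - G1 t) has_real_derivative
          (1 - x) * w (1 - x) * - 1 - - (1 - x) * w x) (at x)"
        using x by (intro DERIV_diff dG1) auto
      then show "((\<lambda>t. G2 (1 - t) - G1 t) has_real_derivative 0) (at x)"
        by (rule DERIV_cong) (simp add: w(2) algebra_simps)
    qed (use t in auto)
    then show ?thesis
      by (simp add: C_def)
  qed
  \<comment> \<open>Comparison with the logarithmic weight makes \<open>G1 + ln\<close>
    nonincreasing. This yields both the blow-up of \<open>G1\<close> at \<open>0\<close> and the
    bound on its limit at \<open>1\<close>.\<close>
  have anti: "G1 y + ln y \<le> G1 x + ln x" if "0 < x" "x \<le> y" "y < 1" for x y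
    using that(2)
  proof (rule DERIV_nonpos_imp_nonincreasing)
    fix z assume z: "x \<le> z" "z \<le> y"
    then have z01: "0 < z" "z < 1"
      using that by auto
    have "(1 - z) * (1 / (z * (1 - z))) \<le> (1 - z) * w z"
      using z01 w(1) by (intro mult_left_mono) auto
    then have "- (1 - z) * w z + 1 / z \<le> 0"
      using z01 unfolding mult_minus_left by simp
    moreover have "((\<lambda>z. G1 z + ln z) has_real_derivative - (1 - z) * w z + 1 / z) (at z)"
      using z01 by (intro DERIV_add dG1 DERIV_ln_divide)
    ultimately show "\<exists>d. ((\<lambda>z. G1 z + ln z) has_real_derivative d) (at z) \<and> d \<le> 0"
      by blast
  qed
  have G1_at_0: "filterlim G1 at_top (at_right 0)"
  proof (rule filterlim_at_top_mono)
    show "filterlim (\<lambda>t. G1 (1 / 2) + ln (1 / 2) + - ln t) at_top (at_right (0::real))"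
      using ln_at_0
      by (intro filterlim_tendsto_add_at_top[OF tendsto_const]) (simp add: filterlim_uminus_at_top)
    have "\<forall>\<^sub>F t in at_right (0::real). t \<in> {0<..<1 / 2}"
      by (rule eventually_at_right_real) simp
    then show "\<forall>\<^sub>F t in at_right 0. G1 (1 / 2) + ln (1 / 2) + - ln t \<le> G1 t"
    proof eventually_elim
      case (elim t)
      then show ?case
        using anti[of t "1 / 2"] by simp
    qed
  qed
  define A1 where "A1 = (INF t\<in>{0<..<1}. ereal (G1 t))"
  have G1_at_1: "((\<lambda>t. ereal (G1 t)) \<longlongrightarrow> A1) (at_left 1)"
    unfolding A1_def
  proof (rule antimono_tendsto_at_left)
    fix x y :: real assume xy: "0 < x" "x \<le> y" "y < 1"
    then have "ln x \<le> ln y"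
      by simp
    then show "ereal (G1 y) \<le> ereal (G1 x)"
      using anti[OF xy] by simp
  qed simp
  \<comment> \<open>Inverting \<open>u = t / (1 - t)\<close> expresses both functions through
    \<open>G1\<close>. As \<open>g2\<close> receives the reversed ratio, both summands of the loss
    evaluate \<open>G1\<close> at the same point.\<close>
  have g1: "g1 u = G1 (u / (1 + u))" and g2: "g2 u = G1 (1 / (1 + u)) + C" if "0 < u" for u
  proof -
    have "u / (1 + u) / (1 - u / (1 + u)) = u" "1 - 1 / (1 + u) = u / (1 + u)"
      using that by (simp_all add: field_simps)
    then show "g1 u = G1 (u / (1 + u))" "g2 u = G1 (1 / (1 + u)) + C"
      using G2[of "1 / (1 + u)"] that by (simp_all add: G1_def G2_def)
  qed
  have inv_tendsto: "((\<lambda>u::real. 1 / (1 + u)) \<longlongrightarrow> 0) at_top"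
    using tendsto_inverse_0_at_top[OF filterlim_tendsto_add_at_top[OF tendsto_const filterlim_ident], of 1]
    by (simp add: inverse_eq_divide)
  have lim_g1_0: "Lim (at_right 0) (\<lambda>u. ereal (g1 u)) = \<infinity>"
  proof (rule tendsto_Lim)
    have "filterlim (\<lambda>u::real. u / (1 + u)) (at_right 0) (at_right 0)"
    proof (rule tendsto_imp_filterlim_at_right)
      show "((\<lambda>u::real. u / (1 + u)) \<longlongrightarrow> 0) (at_right 0)"
        by (auto intro!: tendsto_eq_intros)
    qed (rule eventually_mono[OF eventually_at_right_less], simp)
    then have "filterlim (\<lambda>u. G1 (u / (1 + u))) at_top (at_right 0)"
      by (rule filterlim_compose[OF G1_at_0])
    then show "((\<lambda>u. ereal (g1 u)) \<longlongrightarrow> \<infinity>) (at_right 0)"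
      unfolding tendsto_PInfty_eq_at_top
      by (rule filterlim_cong[THEN iffD1, OF refl refl, rotated])
        (rule eventually_mono[OF eventually_at_right_less], simp add: g1)
  qed simp
  have lim_g2_inf: "Lim at_top (\<lambda>u. ereal (g2 u)) = \<infinity>"
  proof (rule tendsto_Lim)
    have "filterlim (\<lambda>u::real. 1 / (1 + u)) (at_right 0) at_top"
      using inv_tendsto
      by (rule tendsto_imp_filterlim_at_right) (rule eventually_mono[OF eventually_gt_at_top[of 0]], simp)
    then have "filterlim (\<lambda>u. G1 (1 / (1 + u))) at_top at_top"
      by (rule filterlim_compose[OF G1_at_0])
    then have "filterlim (\<lambda>u. C + G1 (1 / (1 + u))) at_top at_top"
      by (intro filterlim_tendsto_add_at_top[OF tendsto_const])
    then show "((\<lambda>u. ereal (g2 u)) \<longlongrightarrow> \<infinity>) at_top"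
      unfolding tendsto_PInfty_eq_at_top
      by (rule filterlim_cong[THEN iffD1, OF refl refl, rotated])
        (rule eventually_mono[OF eventually_gt_at_top[of 0]], simp add: g2)
  qed simp
  have lim_g1_inf: "Lim at_top (\<lambda>u. ereal (g1 u)) = A1"
  proof (rule tendsto_Lim)
    have "filterlim (\<lambda>u::real. 1 - 1 / (1 + u)) (at_left 1) at_top"
    proof (rule tendsto_imp_filterlim_at_left)
      show "((\<lambda>u::real. 1 - 1 / (1 + u)) \<longlongrightarrow> 1) at_top"
        using tendsto_diff[OF tendsto_const inv_tendsto, of 1] by simp
    qed (rule eventually_mono[OF eventually_gt_at_top[of 0]], simp)
    moreover have "1 - 1 / (1 + u) = u / (1 + u)" if "0 < u" for u :: real
      using that by (simp add: divide_simps)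
    then have "\<forall>\<^sub>F u::real in at_top. 1 - 1 / (1 + u) = u / (1 + u)"
      by (rule eventually_mono[OF eventually_gt_at_top[of 0]])
    ultimately have "filterlim (\<lambda>u::real. u / (1 + u)) (at_left 1) at_top"
      by (rule filterlim_cong[OF refl refl, THEN iffD1, rotated])
    then have "((\<lambda>u. ereal (G1 (u / (1 + u)))) \<longlongrightarrow> A1) at_top"
      by (rule filterlim_compose[OF G1_at_1])
    then show "((\<lambda>u. ereal (g1 u)) \<longlongrightarrow> A1) at_top"
      by (rule filterlim_cong[THEN iffD1, OF refl refl, rotated])
        (rule eventually_mono[OF eventually_gt_at_top[of 0]], simp add: g1)
  qed simp
  have lim_g2_0: "Lim (at_right 0) (\<lambda>u. ereal (g2 u)) = A1 + ereal C"
  proof (rule tendsto_Lim)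
    have "filterlim (\<lambda>u::real. 1 / (1 + u)) (at_left 1) (at_right 0)"
    proof (rule tendsto_imp_filterlim_at_left)
      show "((\<lambda>u::real. 1 / (1 + u)) \<longlongrightarrow> 1) (at_right 0)"
        by (auto intro!: tendsto_eq_intros)
    qed (rule eventually_mono[OF eventually_at_right_less], simp)
    then have "((\<lambda>u. ereal (G1 (1 / (1 + u)))) \<longlongrightarrow> A1) (at_right 0)"
      by (rule filterlim_compose[OF G1_at_1])
    then have "((\<lambda>u. ereal (G1 (1 / (1 + u))) + ereal C) \<longlongrightarrow> A1 + ereal C) (at_right 0)"
      by (intro tendsto_add_ereal_general tendsto_const) auto
    then show "((\<lambda>u. ereal (g2 u)) \<longlongrightarrow> A1 + ereal C) (at_right 0)"
      by (rule filterlim_cong[THEN iffD1, OF refl refl, rotated])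
        (rule eventually_mono[OF eventually_at_right_less], simp add: g2)
  qed simp
  \<comment> \<open>At \<open>q $ k = 0\<close> the two summands tend to \<open>A1\<close> and
    \<open>A1 + ereal C\<close>. Giving \<open>\<l> 1\<close> their total lets one real formula
    cover zero coordinates whenever \<open>A\<close> is finite.\<close>
  define A where "A = A1 + (A1 + ereal C)"
  define \<l> where "\<l> t = (if t < 1 then 2 * G1 t + C else real_of_ereal A)" for t
  \<comment> \<open>Letting the upper point of \<open>anti\<close> tend to \<open>1\<close> removes
    its logarithm; doubling gives the bound on \<open>A\<close>.\<close>
  have A1_le: "A1 \<le> ereal (G1 x + ln x)" if x: "0 < x" "x < 1" for x
  proof (rule tendsto_le[OF _ _ G1_at_1])
    have "((\<lambda>t. G1 x + ln x - ln t) \<longlongrightarrow> G1 x + ln x - ln 1) (at_left 1)"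
      by (intro tendsto_intros) auto
    then show "((\<lambda>t. ereal (G1 x + ln x - ln t)) \<longlongrightarrow> ereal (G1 x + ln x)) (at_left 1)"
      by simp
    have "\<forall>\<^sub>F t in at_left 1. t \<in> {x<..<1}"
      using x by (intro eventually_at_left_real)
    then show "\<forall>\<^sub>F t in at_left 1. ereal (G1 t) \<le> ereal (G1 x + ln x - ln t)"
    proof eventually_elim
      case (elim t)
      then show ?case
        using anti[of x t] x by simp
    qed
  qed simp
  have at_ratio_pos: "at_ratio g1 a b + at_ratio g2 b a = ereal (\<l> (a / (a + b)))" if "0 < a" "0 < b" for a b
  proof -
    have "a / b / (1 + a / b) = a / (a + b)" "1 / (1 + b / a) = a / (a + b)"
      using that by (simp_all add: divide_simps)
    then have "at_ratio g1 a b = ereal (G1 (a / (a + b)))" "at_ratio g2 b a = ereal (G1 (a / (a + b)) + C)"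
      using that by (simp_all add: at_ratio_def g1 g2)
    then show ?thesis
      using that by (simp add: \<l>_def)
  qed
  have loss: "pairwise_loss f0 j q = (\<Sum>k\<in>UNIV - {j}. at_ratio g1 (q $ j) (q $ k) + at_ratio g2 (q $ k) (q $ j))"
    for q :: "real ^ 'm" and j
    unfolding pairwise_loss_def g1_def[abs_def] g2_def[abs_def] ..
  show thesis
  proof (rule that[of \<l> A])
    fix x :: real assume x: "0 < x" "x < 1"
    have "((\<lambda>t. 2 * G1 t + C) has_real_derivative - 2 * (1 - x) * w x) (at x)"
      using x by (auto intro!: derivative_eq_intros dG1)
    then show "(\<l> has_real_derivative - 2 * (1 - x) * w x) (at x)"
      by (rule has_field_derivative_transform_within_open[where S = "{..<1}"])
        (use x in \<open>auto simp: \<l>_def\<close>)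
    show "A \<le> ereal (\<l> x + 2 * ln x)"
      using A1_le[OF x] x by (cases A1) (auto simp: A_def \<l>_def)
  next
    have "A1 \<noteq> \<infinity>"
      using A1_le[of "1 / 2"] by auto
    then show "A = -\<infinity> \<or> A = ereal (\<l> 1)"
      by (cases A1) (auto simp: A_def \<l>_def)
  next
    fix q :: "real ^ 'm" and j assume q: "q \<in> prob_simplex" and j: "0 < q $ j"
    show "pairwise_loss f0 j q
        = (\<Sum>k\<in>UNIV - {j}. if 0 < q $ k then ereal (\<l> (q $ j / (q $ j + q $ k))) else A)"
      unfolding loss
    proof (rule sum.cong[OF refl])
      fix k
      show "at_ratio g1 (q $ j) (q $ k) + at_ratio g2 (q $ k) (q $ j)
          = (if 0 < q $ k then ereal (\<l> (q $ j / (q $ j + q $ k))) else A)"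
      proof (cases "0 < q $ k")
        case True
        then show ?thesis
          using at_ratio_pos[OF j True] by simp
      next
        case False
        then show ?thesis
          using j by (simp add: at_ratio_def lim_g1_inf lim_g2_0 A_def)
      qed
    qed
  next
    fix q :: "real ^ 'm" and j assume q: "q \<in> prob_simplex" and j: "q $ j = 0"
    \<comment> \<open>The summand at this \<open>k\<close> is \<open>\<infinity>\<close> and decides
      the sum, whatever the default at \<open>0 / 0\<close> contributes.\<close>
    obtain k where "0 < q $ k"
      using q by (rule simplex_pos_coordinate)
    then show "pairwise_loss f0 j q = \<infinity>"
      unfolding loss sum_Pinfty using j lim_g1_0 lim_g2_inf
      by (auto intro!: bexI[of _ k] simp: at_ratio_def)
  qed
qed

lemma pairwise_regret_bounds:
  fixes am :: "real ^ 'm::finite \<Rightarrow> 'm"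
  assumes am: "argmax_selector am" and weight: "two_class_weight f0 w"
    and w: "\<And>x. 0 < x \<Longrightarrow> x < 1 \<Longrightarrow> 1 / (x * (1 - x)) \<le> w x" "\<And>x. w (1 - x) = w x"
  shows "proper_scoring_rule (pairwise_loss f0 :: 'm \<Rightarrow> real ^ 'm \<Rightarrow> ereal) \<and>
    bregman_regret_bound 2 (pairwise_loss f0 :: 'm \<Rightarrow> real ^ 'm \<Rightarrow> ereal) \<and>
    zero_one_regret_bound am 2 (pairwise_loss f0)"
proof -
  obtain \<l> :: "real \<Rightarrow> real" and A :: ereal where
    \<l>: "\<And>x. 0 < x \<Longrightarrow> x < 1 \<Longrightarrow> (\<l> has_real_derivative - 2 * (1 - x) * w x) (at x)"
    and A: "A = -\<infinity> \<or> A = ereal (\<l> 1)" "\<And>x. 0 < x \<Longrightarrow> x < 1 \<Longrightarrow> A \<le> ereal (\<l> x + 2 * ln x)"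
    and pos: "\<And>(q :: real ^ 'm) j. q \<in> prob_simplex \<Longrightarrow> 0 < q $ j \<Longrightarrow> pairwise_loss f0 j q =
      (\<Sum>k\<in>UNIV - {j}. if 0 < q $ k then ereal (\<l> (q $ j / (q $ j + q $ k))) else A)"
    and zero: "\<And>(q :: real ^ 'm) j. q \<in> prob_simplex \<Longrightarrow> q $ j = 0 \<Longrightarrow> pairwise_loss f0 j q = \<infinity>"
    using pairwise_loss_representation[OF weight w] by blast
  have A_ne: "A \<noteq> \<infinity>"
    using A(1) by auto
  have inf: "pairwise_loss f0 j q = \<infinity> \<longleftrightarrow> q $ j = 0" if "q \<in> prob_simplex" for q :: "real ^ 'm" and j
  proof (cases "q $ j = 0")
    case False
    then have "0 < q $ j"
      using that by (auto simp: prob_simplex_def less_le)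
    then have "pairwise_loss f0 j q \<noteq> \<infinity>"
      unfolding pos[OF that \<open>0 < q $ j\<close>] sum_Pinfty using A_ne by auto
    with False show ?thesis
      by simp
  qed (use zero that in auto)
  have bound: "risk (pairwise_loss f0) \<eta> \<eta> + ereal (2 / 2 * (norm1 (\<eta> - q))\<^sup>2) \<le> risk (pairwise_loss f0) \<eta> q"
    if \<eta>: "\<eta> \<in> prob_simplex" and q: "q \<in> prob_simplex" for \<eta> q :: "real ^ 'm"
  proof -
    have nonneg: "0 \<le> \<eta> $ j" "0 \<le> q $ j" for j
      using \<eta> q by (auto simp: prob_simplex_def)
    \<comment> \<open>Either the right-hand side is \<open>\<infinity>\<close>, or the risk of
      \<open>\<eta>\<close> against itself is \<open>-\<infinity>\<close>, or all values involved
      are real. Only the last case needs an estimate.\<close>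
    consider (undominated) j where "q $ j = 0" "0 < \<eta> $ j"
      | (boundary) i where "A = -\<infinity>" "\<eta> $ i = 0"
      | (finite) "\<And>j. q $ j = 0 \<Longrightarrow> \<eta> $ j = 0" "A = ereal (\<l> 1) \<or> (\<forall>i. 0 < \<eta> $ i)"
    proof -
      have "\<eta> $ i = 0 \<or> 0 < \<eta> $ i" for i
        using nonneg(1)[of i] by (auto simp: less_le)
      with that A(1) show thesis
        by blast
    qed
    then show ?thesis
    proof cases
      case undominated
      then have "risk (pairwise_loss f0) \<eta> q = \<infinity>"
        using zero[OF q] by (intro risk_not_dominated) auto
      then show ?thesis
        by simp
    next
      case boundary
      have minf: "pairwise_loss f0 j \<eta> = -\<infinity>" if "0 < \<eta> $ j" for j
        unfolding pos[OF \<eta> that] using boundary that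
        by (intro sum_eq_MInfty[where i = i]) auto
      moreover obtain j where "0 < \<eta> $ j"
        using \<eta> by (rule simplex_pos_coordinate)
      ultimately have "risk (pairwise_loss f0) \<eta> \<eta> = -\<infinity>"
        unfolding risk_def
      proof (intro sum_eq_MInfty[where i = j])
        fix i
        show "ereal (\<eta> $ i) * pairwise_loss f0 i \<eta> \<noteq> \<infinity>"
          using minf[of i] nonneg(1)[of i]
          by (cases "\<eta> $ i = 0") (auto simp: less_le simp flip: zero_ereal_def)
      qed auto
      then show ?thesis
        by simp
    next
      case finite
      have risk: "risk (pairwise_loss f0) \<eta> v
          = ereal (\<Sum>j\<in>UNIV. \<eta> $ j * (\<Sum>k\<in>UNIV - {j}. \<l> (v $ j / (v $ j + v $ k))))"
        if v: "v \<in> prob_simplex" and dom: "\<And>j. v $ j = 0 \<Longrightarrow> \<eta> $ j = 0" for v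
        using \<eta>
      proof (rule risk_dominated)
        fix j assume "0 < \<eta> $ j"
        moreover have v_nonneg: "0 \<le> v $ k" for k
          using v by (simp add: prob_simplex_def)
        ultimately have j: "0 < v $ j"
          using dom[of j] by (auto simp: less_le)
        \<comment> \<open>A zero coordinate \<open>v $ k\<close> gives the ratio \<open>1\<close>,
          where \<open>\<l> 1 = A\<close> in the first alternative; in the second, domination rules
          it out.\<close>
        have "(if 0 < v $ k then ereal (\<l> (v $ j / (v $ j + v $ k))) else A)
            = ereal (\<l> (v $ j / (v $ j + v $ k)))" for k
          using finite(2) dom[of k] v_nonneg[of k] j by (auto simp: less_le)
        then show "pairwise_loss f0 j v = ereal (\<Sum>k\<in>UNIV - {j}. \<l> (v $ j / (v $ j + v $ k)))"
          unfolding pos[OF v j] by simp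
      qed
      have "\<l> 1 \<le> \<l> x + 2 * ln x" if "\<eta> $ j = 0" "0 < x" "x < 1" for j x
        using A(2)[of x] finite(2) that by (auto dest: spec[of _ j])
      then show ?thesis
        using pairwise_real_bound[OF \<l> w _ \<eta> q finite(1)] risk[OF \<eta>] risk[OF q finite(1)] by simp
    qed
  qed
  show ?thesis
    using am inf bound by (intro regret_bounds_of_risk_bound) auto
qed

text \<open>With \<open>p = x * (1 - x)\<close> the weight is \<open>(4 * p) powr \<nu> / p\<close>,
  and \<open>4 * p \<le> 1\<close> makes the power at least \<open>1\<close> for
  \<open>\<nu> \<le> 0\<close>.\<close>

lemma pairwise_weight_bound:
  fixes \<nu> x :: real
  assumes "\<nu> \<le> 0" "0 < x" "x < 1"
  shows "1 / (x * (1 - x)) \<le> 2 powr (2 * \<nu>) * x powr (\<nu> - 1) * (1 - x) powr (\<nu> - 1)"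
proof -
  define p where "p = x * (1 - x)"
  have p: "0 < p" "4 * p \<le> 1"
    using assms zero_le_power2[of "2 * x - 1"] by (simp_all add: p_def power2_eq_square algebra_simps)
  have four: "2 powr (2 * \<nu>) = 4 powr \<nu>"
    using powr_powr[of 2 2 \<nu>] by simp
  have "1 powr \<nu> \<le> (4 * p) powr \<nu>"
    using assms(1) p by (intro powr_mono2') auto
  also have "(4 * p) powr \<nu> = 2 powr (2 * \<nu>) * p powr \<nu>"
    unfolding four by (rule powr_mult)
  finally have "1 / p \<le> 2 powr (2 * \<nu>) * p powr \<nu> / p"
    using p by (intro divide_right_mono) auto
  also have "\<dots> = 2 powr (2 * \<nu>) * p powr (\<nu> - 1)"
    using p by (simp add: powr_diff)
  also have "p powr (\<nu> - 1) = x powr (\<nu> - 1) * (1 - x) powr (\<nu> - 1)"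
    unfolding p_def by (rule powr_mult)
  finally show ?thesis
    by (simp add: p_def)
qed

theorem proposition10:
  fixes am :: "real ^ 'm \<Rightarrow> 'm"
    and f0 :: "real \<Rightarrow> real"
    and \<nu> \<beta> :: real
  assumes m: "CARD('m) \<ge> 2"
    and am: "argmax_selector am"
  shows
    "(convex_on {0<..} f0 \<and> f0 differentiable_on {0<..} \<and> deriv f0 differentiable_on {0<..} \<and>
      two_class_weight f0
        (\<lambda>x. 2 powr (2 * \<nu>) * x powr (\<nu> - 1) * (1 - x) powr (\<nu> - 1)) \<and>
      \<nu> \<le> 0 \<longrightarrow>
        proper_scoring_rule (pairwise_loss f0 :: 'm \<Rightarrow> real ^ 'm \<Rightarrow> ereal) \<and>
        bregman_regret_bound 2 (pairwise_loss f0 :: 'm \<Rightarrow> real ^ 'm \<Rightarrow> ereal) \<and>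
        zero_one_regret_bound am 2 (pairwise_loss f0))
     \<and>
     (0 < \<beta> \<and> \<beta> < 1 \<longrightarrow>
        proper_scoring_rule (simultaneous_loss \<beta> :: 'm \<Rightarrow> real ^ 'm \<Rightarrow> ereal))
     \<and>
     (1 / 2 \<le> \<beta> \<and> \<beta> < 1 \<longrightarrow>
        kappa_upper CARD('m) \<beta> > 0 \<and>
        bregman_regret_bound (kappa_upper CARD('m) \<beta>) (simultaneous_loss \<beta> :: 'm \<Rightarrow> real ^ 'm \<Rightarrow> ereal) \<and>
        zero_one_regret_bound am (kappa_upper CARD('m) \<beta>) (simultaneous_loss \<beta>))
     \<and>
     (0 < \<beta> \<and> \<beta> \<le> 1 / 2 \<longrightarrow>
        kappa_lower \<beta> > 0 \<and>
        bregman_regret_bound (kappa_lower \<beta>) (simultaneous_loss \<beta> :: 'm \<Rightarrow> real ^ 'm \<Rightarrow> ereal) \<and>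
        zero_one_regret_bound am (kappa_lower \<beta>) (simultaneous_loss \<beta>))
     \<and>
     kappa_upper CARD('m) (1 / 2) = 1 \<and> kappa_lower (1 / 2) = 1"
proof (intro conjI)
  show "convex_on {0<..} f0 \<and> f0 differentiable_on {0<..} \<and> deriv f0 differentiable_on {0<..} \<and>
      two_class_weight f0
        (\<lambda>x. 2 powr (2 * \<nu>) * x powr (\<nu> - 1) * (1 - x) powr (\<nu> - 1)) \<and>
      \<nu> \<le> 0 \<longrightarrow>
        proper_scoring_rule (pairwise_loss f0 :: 'm \<Rightarrow> real ^ 'm \<Rightarrow> ereal) \<and>
        bregman_regret_bound 2 (pairwise_loss f0 :: 'm \<Rightarrow> real ^ 'm \<Rightarrow> ereal) \<and>
        zero_one_regret_bound am 2 (pairwise_loss f0)"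
  proof (intro impI, elim conjE)
    assume weight: "two_class_weight f0
        (\<lambda>x. 2 powr (2 * \<nu>) * x powr (\<nu> - 1) * (1 - x) powr (\<nu> - 1))"
      and "\<nu> \<le> 0"
    then show "proper_scoring_rule (pairwise_loss f0 :: 'm \<Rightarrow> real ^ 'm \<Rightarrow> ereal) \<and>
        bregman_regret_bound 2 (pairwise_loss f0 :: 'm \<Rightarrow> real ^ 'm \<Rightarrow> ereal) \<and>
        zero_one_regret_bound am 2 (pairwise_loss f0)"
      by (intro pairwise_regret_bounds[OF am weight] pairwise_weight_bound) simp_all
  qed
  show "0 < \<beta> \<and> \<beta> < 1 \<longrightarrow>
      proper_scoring_rule (simultaneous_loss \<beta> :: 'm \<Rightarrow> real ^ 'm \<Rightarrow> ereal)"
    \<comment> \<open>The choice \<open>\<kappa> = 0\<close> meets both bounds on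
      \<open>\<kappa>\<close> for every \<open>\<beta>\<close> in the range, which isolates
      propriety.\<close>
    using simultaneous_regret_bounds[OF am, of \<beta> 0] kappa_lower_pos[of \<beta>] by auto
  show "1 / 2 \<le> \<beta> \<and> \<beta> < 1 \<longrightarrow>
      kappa_upper CARD('m) \<beta> > 0 \<and>
      bregman_regret_bound (kappa_upper CARD('m) \<beta>) (simultaneous_loss \<beta> :: 'm \<Rightarrow> real ^ 'm \<Rightarrow> ereal) \<and>
      zero_one_regret_bound am (kappa_upper CARD('m) \<beta>) (simultaneous_loss \<beta>)"
    using simultaneous_regret_bounds[OF am, of \<beta> "kappa_upper CARD('m) \<beta>"] m
      kappa_upper_pos[of \<beta> "CARD('m)"] kappa_upper_le_kappa_lower[of \<beta> "CARD('m)"] by auto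
  show "0 < \<beta> \<and> \<beta> \<le> 1 / 2 \<longrightarrow>
      kappa_lower \<beta> > 0 \<and>
      bregman_regret_bound (kappa_lower \<beta>) (simultaneous_loss \<beta> :: 'm \<Rightarrow> real ^ 'm \<Rightarrow> ereal) \<and>
      zero_one_regret_bound am (kappa_lower \<beta>) (simultaneous_loss \<beta>)"
    using simultaneous_regret_bounds[OF am, of \<beta> "kappa_lower \<beta>"] kappa_lower_pos[of \<beta>] by auto
  show "kappa_upper CARD('m) (1 / 2) = 1" "kappa_lower (1 / 2) = 1"
    by (simp_all add: kappa_upper_def kappa_lower_def)
qed

end
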